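(* Suppose that for every $\varepsilon>0$ and every set of at most $n$ points with positive weights, a point whose weighted sum of distances to the given points is at most $(1+\varepsilon)$ times the minimum possible (a $(1+\varepsilon)$-approximate Weber point) can be computed in time $T_{\mathrm{Weber}}(n,\varepsilon)$. Then source-equally-spaced circular instances of FLaMECaST with one intermediate layer, one sink and $n$ sources can be approximated within a factor of $1+\varepsilon$ (i.e., a valid layout of cost at most $(1+\varepsilon)$ times the minimum can be computed) in $O(n\cdot T_{\mathrm{Weber}}(n,\varepsilon)+n^2)$ time.
   Context: FLaMECaST: an instance $I=(S,T,C,\alpha)$ consists of a finite set $S$ of sources and a finite set $T$ of sinks, each with a fixed position in $\mathbb{R}^2$, capacities $C=(c_0,\dots,c_{\lambda+1})$ with integers $c_0\ge\dots\ge c_{\lambda+1}\ge 1$ ($\lambda$ = number of intermediate layers; here $\lambda=1$), and $\alpha\in[0,1]$. A topology is a rooted forest (edges directed from child to parent) of height at most $\lambda+1$ whose leaves are exactly $S$ and whose roots lie in $T$ (other vertices are Steiner vertices); the layer of a vertex is its distance to its root; the load $\ell(v)$ is the number of sources in the subtree of $v$ and the load of edge $uv$ ($u$ child) is $\ell(u)$; it is valid if $\ell(v)\le c_i$ for every vertex $v$ in layer $i$. An embedding maps sources and sinks to their positions and Steiner vertices to arbitrary points; edge cost is $\|\mathrm{pos}(u)-\mathrm{pos}(v)\|\cdot\ell(uv)^\alpha$; a layout is a topology with an embedding, its cost the sum of edge costs; the goal is a valid layout of minimum cost. A circular instance has all sources on a circle and all sinks at its center; it is source-equally-spaced if the $n$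 sources are evenly distributed on the circle (consecutive sources separated by angle $2\pi/n$). *)

theory Defs
  imports "HOL-Analysis.Analysis"
begin

section \<open>A real RAM with cost semantics\<close>

text \<open>
  Programs are WHILE programs over a memory of arrays of natural numbers and arrays of real
  numbers; the array names are fixed in the program text, the indices are computed at run time.
  Every operation costs one time unit. Natural numbers have only addition, truncated subtraction
  and comparison; there is no conversion from reals to naturals (no rounding), and no real
  constants other than those obtained from natural numbers. The power of a natural number with a
  real exponent is a primitive because the load-dependent factor of an edge cost has that form.
\<close>

datatype nexp =
    NConst nat
  | NArr nat nexp
  | NAdd nexp nexp
  | NSub nexp nexp

datatype rexp =
    RNat nexp
  | RArr nat nexp
  | RAdd rexp rexp
  | RSub rexp rexp
  | RMul rexp rexp
  | RDiv rexp rexp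
  | RSqrt rexp
  | RPow nexp rexp

datatype bexp =
    NLess nexp nexp
  | RLess rexp rexp
  | BNot bexp
  | BAnd bexp bexp

datatype com =
    SKIP
  | NASSIGN nat nexp nexp
  | RASSIGN nat nexp rexp
  | SEQ com com
  | COND bexp com com
  | WHILE bexp com

record state =
  nats :: "nat \<Rightarrow> nat \<Rightarrow> nat"
  reals :: "nat \<Rightarrow> nat \<Rightarrow> real"

primrec nval :: "nexp \<Rightarrow> state \<Rightarrow> nat" where
  "nval (NConst k) s = k"
| "nval (NArr a e) s = nats s a (nval e s)"
| "nval (NAdd e f) s = nval e s + nval f s"
| "nval (NSub e f) s = nval e s - nval f s"

primrec rval :: "rexp \<Rightarrow> state \<Rightarrow> real" where
  "rval (RNat e) s = real (nval e s)"
| "rval (RArr a e) s = reals s a (nval e s)"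
| "rval (RAdd e f) s = rval e s + rval f s"
| "rval (RSub e f) s = rval e s - rval f s"
| "rval (RMul e f) s = rval e s * rval f s"
| "rval (RDiv e f) s = rval e s / rval f s"
| "rval (RSqrt e) s = sqrt (rval e s)"
| "rval (RPow e f) s = real (nval e s) powr rval f s"

primrec bval :: "bexp \<Rightarrow> state \<Rightarrow> bool" where
  "bval (NLess e f) s = (nval e s < nval f s)"
| "bval (RLess e f) s = (rval e s < rval f s)"
| "bval (BNot b) s = (\<not> bval b s)"
| "bval (BAnd b c) s = (bval b s \<and> bval c s)"

primrec ncost :: "nexp \<Rightarrow> nat" where
  "ncost (NConst k) = 1"
| "ncost (NArr a e) = ncost e + 1"
| "ncost (NAdd e f) = ncost e + ncost f + 1"
| "ncost (NSub e f) = ncost e + ncost f + 1"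

primrec rcost :: "rexp \<Rightarrow> nat" where
  "rcost (RNat e) = ncost e + 1"
| "rcost (RArr a e) = ncost e + 1"
| "rcost (RAdd e f) = rcost e + rcost f + 1"
| "rcost (RSub e f) = rcost e + rcost f + 1"
| "rcost (RMul e f) = rcost e + rcost f + 1"
| "rcost (RDiv e f) = rcost e + rcost f + 1"
| "rcost (RSqrt e) = rcost e + 1"
| "rcost (RPow e f) = ncost e + rcost f + 1"

primrec bcost :: "bexp \<Rightarrow> nat" where
  "bcost (NLess e f) = ncost e + ncost f + 1"
| "bcost (RLess e f) = rcost e + rcost f + 1"
| "bcost (BNot b) = bcost b + 1"
| "bcost (BAnd b c) = bcost b + bcost c + 1"

definition nset :: "nat \<Rightarrow> nat \<Rightarrow> nat \<Rightarrow> state \<Rightarrow> state" where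
  "nset a i x s = s\<lparr>nats := (nats s)(a := (nats s a)(i := x))\<rparr>"

definition rset :: "nat \<Rightarrow> nat \<Rightarrow> real \<Rightarrow> state \<Rightarrow> state" where
  "rset a i x s = s\<lparr>reals := (reals s)(a := (reals s a)(i := x))\<rparr>"

text \<open>\<open>exec c s t s'\<close>: started in \<open>s\<close>, program \<open>c\<close> halts after exactly \<open>t\<close> time units in \<open>s'\<close>.\<close>

inductive exec :: "com \<Rightarrow> state \<Rightarrow> nat \<Rightarrow> state \<Rightarrow> bool" where
  exec_SKIP: "exec SKIP s 1 s"
| exec_NASSIGN: "exec (NASSIGN a e f) s (ncost e + ncost f + 1) (nset a (nval e s) (nval f s) s)"
| exec_RASSIGN: "exec (RASSIGN a e f) s (ncost e + rcost f + 1) (rset a (nval e s) (rval f s) s)"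
| exec_SEQ: "exec c s t s' \<Longrightarrow> exec d s' u s'' \<Longrightarrow> exec (SEQ c d) s (t + u) s''"
| exec_COND_True: "bval b s \<Longrightarrow> exec c s t s' \<Longrightarrow> exec (COND b c d) s (bcost b + t + 1) s'"
| exec_COND_False: "\<not> bval b s \<Longrightarrow> exec d s t s' \<Longrightarrow> exec (COND b c d) s (bcost b + t + 1) s'"
| exec_WHILE_False: "\<not> bval b s \<Longrightarrow> exec (WHILE b c) s (bcost b + 1) s"
| exec_WHILE_True: "bval b s \<Longrightarrow> exec c s t s' \<Longrightarrow> exec (WHILE b c) s' u s'' \<Longrightarrow>
    exec (WHILE b c) s (bcost b + t + u + 1) s''"

inductive_cases exec_SKIP_E: "exec SKIP s t s'"
inductive_cases exec_NASSIGN_E: "exec (NASSIGN a e f) s t s'"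
inductive_cases exec_RASSIGN_E: "exec (RASSIGN a e f) s t s'"
inductive_cases exec_SEQ_E: "exec (SEQ c d) s t s'"
inductive_cases exec_COND_E: "exec (COND b c d) s t s'"
inductive_cases exec_WHILE_E: "exec (WHILE b c) s t s'"

lemma exec_deterministic:
  "exec c s t s' \<Longrightarrow> exec c s u s'' \<Longrightarrow> u = t \<and> s'' = s'"
proof (induction arbitrary: u s'' rule: exec.induct)
  case (exec_SEQ c s t s' d v s1)
  from exec_SEQ.prems obtain t' v' x where
    "exec c s t' x" "exec d x v' s''" "u = t' + v'" by (rule exec_SEQ_E)
  then show ?case using exec_SEQ.IH by metis
next
  case (exec_WHILE_True b s c t s' v s1)
  from exec_WHILE_True.prems exec_WHILE_True.hyps(1) obtain t' v' x where
    "exec c s t' x" "exec (WHILE b c) x v' s''" "u = bcost b + t' + v' + 1"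
    by (auto elim: exec_WHILE_E)
  then show ?case using exec_WHILE_True.IH by metis
next
  case (exec_COND_True b s c t s' d)
  from exec_COND_True.prems exec_COND_True.hyps(1) obtain t' where
    "exec c s t' s''" "u = bcost b + t' + 1" by (auto elim: exec_COND_E)
  then show ?case using exec_COND_True.IH by metis
next
  case (exec_COND_False b s d t s' c)
  from exec_COND_False.prems exec_COND_False.hyps(1) obtain t' where
    "exec d s t' s''" "u = bcost b + t' + 1" by (auto elim: exec_COND_E)
  then show ?case using exec_COND_False.IH by metis
next
  case (exec_WHILE_False b s c)
  from exec_WHILE_False.prems exec_WHILE_False.hyps show ?case by (auto elim: exec_WHILE_E)
qed (auto elim: exec_SKIP_E exec_NASSIGN_E exec_RASSIGN_E)


section \<open>Approximate Weber points\<close>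

type_synonym point = "real \<times> real"

definition weighted_dist :: "(point \<times> real) list \<Rightarrow> point \<Rightarrow> real" where
  "weighted_dist P x = (\<Sum>(p, w)\<leftarrow>P. w * dist x p)"

definition approx_weber_point :: "real \<Rightarrow> (point \<times> real) list \<Rightarrow> point \<Rightarrow> bool" where
  "approx_weber_point \<epsilon> P x \<longleftrightarrow>
     (\<forall>y. weighted_dist P x \<le> (1 + \<epsilon>) * weighted_dist P y)"

definition weighted_point_set :: "(point \<times> real) list \<Rightarrow> bool" where
  "weighted_point_set P \<longleftrightarrow> P \<noteq> [] \<and> distinct (map fst P) \<and> (\<forall>(p, w)\<in>set P. 0 < w)"

text \<open>
  Input and output conventions. Memory cells that are not mentioned are uninitialised: a program
  has to work for arbitrary contents of them.
\<close>

definition weber_input :: "real \<Rightarrow> (point \<times> real) list \<Rightarrow> state \<Rightarrow> bool" where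
  "weber_input \<epsilon> P s \<longleftrightarrow>
     nats s 0 0 = length P \<and> reals s 0 0 = \<epsilon> \<and>
     (\<forall>i<length P. reals s 1 i = fst (fst (P ! i)) \<and> reals s 2 i = snd (fst (P ! i)) \<and>
        reals s 3 i = snd (P ! i))"

definition weber_output :: "state \<Rightarrow> point" where
  "weber_output s = (reals s 4 0, reals s 4 1)"

definition weber_solver :: "com \<Rightarrow> (nat \<Rightarrow> real \<Rightarrow> real) \<Rightarrow> bool" where
  "weber_solver p T \<longleftrightarrow>
     (\<forall>n. \<forall>\<epsilon>>0. \<forall>P s. weighted_point_set P \<and> length P \<le> n \<and> weber_input \<epsilon> P s \<longrightarrow>
        (\<exists>t s'. exec p s t s' \<and> real t \<le> T n \<epsilon> \<and> approx_weber_point \<epsilon> P (weber_output s')))"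


section \<open>FLaMECaST\<close>

record flamecast =
  sources :: "point list"
  sinks :: "point list"
  capacities :: "nat list"
  alpha :: real

definition num_layers :: "flamecast \<Rightarrow> nat" where
  "num_layers I = length (capacities I) - 2"

definition flamecast_instance :: "flamecast \<Rightarrow> bool" where
  "flamecast_instance I \<longleftrightarrow>
     2 \<le> length (capacities I) \<and> sorted_wrt (\<ge>) (capacities I) \<and>
     (\<forall>c\<in>set (capacities I). 1 \<le> c) \<and> 0 \<le> alpha I \<and> alpha I \<le> 1"

datatype vertex = Source nat | Sink nat | Steiner nat

definition source_vertices :: "flamecast \<Rightarrow> vertex set" where
  "source_vertices I = Source ` {..<length (sources I)}"

definition sink_vertices :: "flamecast \<Rightarrow> vertex set" where
  "sink_vertices I = Sink ` {..<length (sinks I)}"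

text \<open>Edges are pairs (child, parent).\<close>

record layout =
  verts :: "vertex set"
  edges :: "(vertex \<times> vertex) set"
  pos :: "vertex \<Rightarrow> point"

definition roots :: "layout \<Rightarrow> vertex set" where
  "roots L = {v \<in> verts L. \<nexists>u. (v, u) \<in> edges L}"

definition leaves :: "layout \<Rightarrow> vertex set" where
  "leaves L = {v \<in> verts L. \<nexists>u. (u, v) \<in> edges L}"

definition rooted_forest :: "layout \<Rightarrow> bool" where
  "rooted_forest L \<longleftrightarrow>
     finite (verts L) \<and> edges L \<subseteq> verts L \<times> verts L \<and> single_valued (edges L) \<and> acyclic (edges L)"

definition layer :: "layout \<Rightarrow> vertex \<Rightarrow> nat" where
  "layer L v = (LEAST k. \<exists>r\<in>roots L. (v, r) \<in> edges L ^^ k)"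

definition load :: "flamecast \<Rightarrow> layout \<Rightarrow> vertex \<Rightarrow> nat" where
  "load I L v = card {u \<in> source_vertices I. (u, v) \<in> (edges L)\<^sup>*}"

definition topology :: "flamecast \<Rightarrow> layout \<Rightarrow> bool" where
  "topology I L \<longleftrightarrow>
     rooted_forest L \<and>
     (\<forall>v\<in>verts L. layer L v \<le> num_layers I + 1) \<and>
     leaves L = source_vertices I \<and> roots L \<subseteq> sink_vertices I \<and>
     verts L - leaves L - roots L \<subseteq> range Steiner"

definition embedding :: "flamecast \<Rightarrow> layout \<Rightarrow> bool" where
  "embedding I L \<longleftrightarrow>
     (\<forall>i. Source i \<in> verts L \<longrightarrow> pos L (Source i) = sources I ! i) \<and>
     (\<forall>j. Sink j \<in> verts L \<longrightarrow> pos L (Sink j) = sinks I ! j)"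

definition valid_layout :: "flamecast \<Rightarrow> layout \<Rightarrow> bool" where
  "valid_layout I L \<longleftrightarrow>
     topology I L \<and> embedding I L \<and> (\<forall>v\<in>verts L. load I L v \<le> capacities I ! layer L v)"

definition layout_cost :: "flamecast \<Rightarrow> layout \<Rightarrow> real" where
  "layout_cost I L =
     (\<Sum>(u, v)\<in>edges L. dist (pos L u) (pos L v) * real (load I L u) powr alpha I)"

definition approx_layout :: "real \<Rightarrow> flamecast \<Rightarrow> layout \<Rightarrow> bool" where
  "approx_layout \<epsilon> I L \<longleftrightarrow>
     valid_layout I L \<and>
     (\<forall>L'. valid_layout I L' \<longrightarrow> layout_cost I L \<le> (1 + \<epsilon>) * layout_cost I L')"

definition circular_about :: "flamecast \<Rightarrow> point \<Rightarrow> real \<Rightarrow> bool" where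
  "circular_about I z r \<longleftrightarrow>
     0 < r \<and> set (sources I) \<subseteq> sphere z r \<and> set (sinks I) \<subseteq> {z}"

text \<open>
  The sources are listed in no particular order. As the points on the right are pairwise distinct
  and as many as there are sources, each of them is the position of exactly one source.
\<close>

definition source_equally_spaced_circular :: "flamecast \<Rightarrow> bool" where
  "source_equally_spaced_circular I \<longleftrightarrow>
     (\<exists>z r \<theta>. circular_about I z r \<and>
        set (sources I) =
          (\<lambda>i. z + r *\<^sub>R (cos (\<theta> + 2 * pi * real i / real (length (sources I))),
                         sin (\<theta> + 2 * pi * real i / real (length (sources I)))))
            ` {..<length (sources I)})"

definition flamecast_input :: "real \<Rightarrow> flamecast \<Rightarrow> state \<Rightarrow> bool" where
  "flamecast_input \<epsilon> I s \<longleftrightarrow>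
     nats s 0 0 = length (sources I) \<and> nats s 0 1 = length (sinks I) \<and>
     nats s 0 2 = num_layers I \<and>
     (\<forall>i<length (capacities I). nats s 1 i = capacities I ! i) \<and>
     reals s 0 0 = \<epsilon> \<and> reals s 0 1 = alpha I \<and>
     (\<forall>i<length (sources I).
        reals s 1 i = fst (sources I ! i) \<and> reals s 2 i = snd (sources I ! i)) \<and>
     (\<forall>j<length (sinks I).
        reals s 3 j = fst (sinks I ! j) \<and> reals s 4 j = snd (sinks I ! j))"

text \<open>
  A computed layout is given by parent pointers and coordinates: nat array 2 holds the parents of
  the sources, nat array 3 the parents of the Steiner vertices, whose number is in cell 0 of nat
  array 4 and whose coordinates are in real arrays 5 and 6. With \<open>k\<close> sinks, a pointer below \<open>k\<close>
  denotes a sink and the pointer \<open>k + j\<close> denotes Steiner vertex \<open>j\<close>.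
\<close>

definition flamecast_output :: "flamecast \<Rightarrow> state \<Rightarrow> layout" where
  "flamecast_output I s =
     (let k = length (sinks I);
          target = (\<lambda>x. if x < k then Sink x else Steiner (x - k));
          E = (\<lambda>i. (Source i, target (nats s 2 i))) ` {..<length (sources I)} \<union>
              (\<lambda>j. (Steiner j, target (nats s 3 j))) ` {..<nats s 4 0}
      in \<lparr>verts = Field E, edges = E,
          pos = (\<lambda>v. case v of
                   Source i \<Rightarrow> sources I ! i
                 | Sink j \<Rightarrow> sinks I ! j
                 | Steiner j \<Rightarrow> (reals s 5 j, reals s 6 j))\<rparr>)"

end

theory Submission
  imports Defs
begin

text \<open>
  In a valid layout every child of the sink serves a group of at most \<open>c\<^sub>1\<close> sources. Among all groups of
  \<open>k\<close> sources an arc of \<open>k\<close> consecutive ones is cheapest: for a fixed Steiner point \<open>y\<close> the \<open>k\<close> sources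
  closest to \<open>y\<close> are consecutive, and rotations make all arcs of \<open>k\<close> sources equivalent. Hence it suffices
  to price one arc for every \<open>k\<close>, which is a Weber problem with \<open>k + 1\<close> points, and to choose the sizes of
  the groups by dynamic programming. For \<open>k = n\<close> the solver may not be called, as the problem has
  \<open>n + 1\<close> points, but there the center is optimal by symmetry; it also is for \<open>k = 1\<close>.

  The sources come unordered and the machine has no trigonometric functions. A source with the largest inner
  product with source 0 is a neighbour of it, so the complex quotient of the two is a rotation by
  \<open>\<plusminus>2\<pi>/n\<close>; its powers list the sources in cyclic order, and exact comparison identifies them.
\<close>

section \<open>Equally spaced points on a circle\<close>

text \<open>The sizes of the groups are all that matters: arcs of any sizes summing to the number of
  sources tile the circle, so a cheapest arc can be used for every group at once without conflict.
  The factor 1 + \<epsilon> does not accumulate, because the dynamic program is exact for the prices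
  that the computed Steiner points really achieve, and each price is within 1 + \<epsilon> of the
  cost of any group of that size. A source attached directly to the sink counts as a group of size
  one served from its own position; the output gives it a Steiner vertex at the sink instead, at the
  same cost. Only the capacity of layer 1 restricts the choice: layer 2 holds single sources, and
  the capacity of layer 0 decides merely whether a valid layout exists. The search cannot tell which
  of the two neighbours it has found, so an orientation \<sigma>, either 1 or -1, is carried along;
  positions are integers so that an arc may start anywhere.\<close>

definition turn :: "real \<Rightarrow> nat \<Rightarrow> int \<Rightarrow> complex" where
  "turn \<sigma> n i = cis (\<sigma> * 2 * pi * of_int i / real n)"

lemma norm_turn [simp]: "cmod (turn \<sigma> n i) = 1"
  by (simp add: turn_def)

lemma turn_0 [simp]: "turn \<sigma> n 0 = 1"
  by (simp add: turn_def)

lemma turn_add: "turn \<sigma> n (i + j) = turn \<sigma> n i * turn \<sigma> n j"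
  by (simp add: turn_def cis_mult algebra_simps add_divide_distrib)

lemma turn_power: "turn \<sigma> n 1 ^ k = turn \<sigma> n (int k)"
  unfolding turn_def Complex.DeMoivre by (rule arg_cong[of _ _ cis]) simp

lemma turn_minus: "turn \<sigma> n (- i) = cnj (turn \<sigma> n i)"
  by (simp add: turn_def cis_cnj)

lemma turn_uminus_eq: "turn (- 1) n i = turn 1 n (- i)"
  by (simp add: turn_def)

lemma turn_period:
  assumes "n \<ge> 1" "\<sigma> = 1 \<or> \<sigma> = -1"
  shows "turn \<sigma> n (i + int n * q) = turn \<sigma> n i"
proof -
  have *: "turn 1 n (j + int n * q) = turn 1 n j" for j q
    using assms(1) cis_multiple_2pi[of "of_int q"]
    by (simp add: turn_def algebra_simps add_divide_distrib flip: cis_mult)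
  show ?thesis
    using assms(2) *[of "-i" "-q"] *[of i q] by (auto simp: turn_uminus_eq)
qed

lemma turn_mod:
  assumes "n \<ge> 1" "\<sigma> = 1 \<or> \<sigma> = -1"
  shows "turn \<sigma> n (i mod int n) = turn \<sigma> n i"
  using turn_period[OF assms, of "i mod int n" "i div int n"] by simp

lemma turn_eq_1_imp_dvd:
  assumes "n \<ge> 1" "\<sigma> = 1 \<or> \<sigma> = -1" "turn \<sigma> n i = 1"
  shows "int n dvd i"
proof -
  have "turn 1 n i = 1"
  proof (cases "\<sigma> = 1")
    case False
    then have "cnj (turn 1 n i) = 1" using assms(2,3) by (simp add: turn_uminus_eq turn_minus)
    then show ?thesis by (metis complex_cnj_cnj complex_cnj_one)
  qed (use assms in simp)
  then have "cos (2 * pi * of_int i / real n) = 1"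
    by (simp add: turn_def complex_eq_iff)
  then obtain m :: int where "2 * pi * of_int i / real n = of_int m * 2 * pi"
    by (auto simp: cos_one_2pi_int)
  then have "of_int i = real_of_int (m * int n)"
    using assms(1) by (simp add: field_simps)
  then have "i = m * int n" by (simp only: of_int_eq_iff)
  then show ?thesis by simp
qed

text \<open>Equal rotations have a quotient equal to 1, so their positions differ by a multiple of
  n, and a window of at most n positions leaves only the multiple 0.\<close>

lemma turn_inj_on_window:
  assumes "n \<ge> 1" "\<sigma> = 1 \<or> \<sigma> = -1" "k \<le> n"
  shows "inj_on (turn \<sigma> n) {m..<m + int k}"
proof (rule inj_onI)
  fix i j assume ij: "i \<in> {m..<m + int k}" "j \<in> {m..<m + int k}" "turn \<sigma> n i = turn \<sigma> n j"
  have "turn \<sigma> n (i - j) = turn \<sigma> n j * cnj (turn \<sigma> n j)"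
    using turn_add[of \<sigma> n i "-j"] ij(3) by (simp add: turn_minus)
  also have "\<dots> = 1" using complex_norm_square[of "turn \<sigma> n j"] by simp
  finally have "int n dvd i - j" using assms turn_eq_1_imp_dvd by blast
  moreover have "\<bar>i - j\<bar> < int n" using ij assms(3) by auto
  ultimately have "i - j = 0" using dvd_imp_le_int[of "i - j" "int n"] by linarith
  then show "i = j" by simp
qed

text \<open>A window of n positions meets every residue class. This allows the circle to be cut open
  at any position, in particular at the start of an arc under study.\<close>

lemma turn_image_window:
  assumes "n \<ge> 1" "\<sigma> = 1 \<or> \<sigma> = -1"
  shows "turn \<sigma> n ` {m..<m + int n} = range (turn \<sigma> n)"
proof -
  have "turn \<sigma> n i \<in> turn \<sigma> n ` {m..<m + int n}" for i
  proof
    show "turn \<sigma> n i = turn \<sigma> n (m + (i - m) mod int n)"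
      using turn_mod[OF assms, of "i - m"] turn_add[of \<sigma> n m] 
      by (metis add.commute diff_add_cancel)
    show "m + (i - m) mod int n \<in> {m..<m + int n}" using assms(1) by simp
  qed
  then show ?thesis by blast
qed

section \<open>Distances to equally spaced points: the closest ones are consecutive\<close>

lemma norm_diff_polar:
  fixes s y :: complex
  assumes "s = rcis r \<theta>" "y = rcis \<rho> \<psi>"
  shows "cmod (s * cis \<phi> - y) = sqrt (r\<^sup>2 + \<rho>\<^sup>2 - 2 * r * \<rho> * cos (\<theta> + \<phi> - \<psi>))"
proof -
  have s: "s * cis \<phi> = rcis r (\<theta> + \<phi>)" by (simp add: assms(1) rcis_def cis_mult)
  have "(cmod (s * cis \<phi> - y))\<^sup>2 = (r * cos (\<theta> + \<phi>) - \<rho> * cos \<psi>)\<^sup>2 + (r * sin (\<theta> + \<phi>) - \<rho> * sin \<psi>)\<^sup>2"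
    by (simp add: s assms(2) cmod_power2)
  also have "\<dots> = r\<^sup>2 * ((cos (\<theta> + \<phi>))\<^sup>2 + (sin (\<theta> + \<phi>))\<^sup>2) + \<rho>\<^sup>2 * ((cos \<psi>)\<^sup>2 + (sin \<psi>)\<^sup>2)
      - 2 * r * \<rho> * (cos (\<theta> + \<phi>) * cos \<psi> + sin (\<theta> + \<phi>) * sin \<psi>)"
    by (simp only: power2_eq_square) algebra
  also have "\<dots> = r\<^sup>2 + \<rho>\<^sup>2 - 2 * r * \<rho> * cos (\<theta> + \<phi> - \<psi>)"
    by (simp add: cos_diff)
  finally show ?thesis by (metis norm_ge_zero real_sqrt_unique)
qed

lemma cos_ge_cos_of_abs_le: "\<bar>t\<bar> \<le> x \<Longrightarrow> x \<le> pi \<Longrightarrow> cos x \<le> cos t"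
  using cos_monotone_0_pi_le[of "\<bar>t\<bar>" x] by (simp add: cos_abs_real)

lemma cos_le_cos_of_between:
  assumes "0 \<le> x" "x \<le> t" "t \<le> 2 * pi - x"
  shows "cos t \<le> cos x"
proof (cases "t \<le> pi")
  case True
  then show ?thesis using assms by (intro cos_monotone_0_pi_le) auto
next
  case False
  have "cos (2 * pi - t) \<le> cos x" using assms False by (intro cos_monotone_0_pi_le) auto
  then show ?thesis by simp
qed

text \<open>An exchange argument: \<open>W - S\<close> and \<open>S - W\<close> have the same
  cardinality, and the threshold \<open>d\<close> separates the values on the former from those on
  the latter.\<close>

lemma sum_le_sum_of_threshold:
  fixes f :: "'a \<Rightarrow> real"
  assumes "finite C" "S \<subseteq> C" "W \<subseteq> C" "card S = card W"
    and "\<And>p. p \<in> W \<Longrightarrow> f p \<le> d" "\<And>p. p \<in> C - W \<Longrightarrow> d \<le> f p"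
  shows "sum f W \<le> sum f S"
proof -
  have fin: "finite S" "finite W" using assms finite_subset by auto
  have c: "card (W - S) = card (S - W)"
    using card_Diff_subset_Int[of W S] card_Diff_subset_Int[of S W] fin assms(4) by (simp add: Int_commute)
  have "sum f W = sum f (W - S) + sum f (S \<inter> W)"
    using sum.Int_Diff[OF fin(2), of f S] by (simp add: Int_commute)
  also have "sum f (W - S) \<le> of_nat (card (W - S)) * d" using assms(5) by (intro sum_bounded_above) auto
  also have "\<dots> \<le> sum f (S - W)" unfolding c using assms(2,6) by (intro sum_bounded_below) auto
  also have "sum f (S - W) + sum f (S \<inter> W) = sum f S"
    using sum.Int_Diff[OF fin(1), of f W] by simp
  finally show ?thesis by simp
qed

text \<open>By the law of cosines the distance to y is a monotone function of the angle to the
  direction of y, so the k nearest points fill a window centred on that direction. For y = 0 all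
  distances agree and any window serves.\<close>

lemma consecutive_arc_closest:
  fixes s y :: complex
  assumes n: "n \<ge> 1" and \<sigma>: "\<sigma> = 1 \<or> \<sigma> = -1" and s: "s \<noteq> 0"
    and S: "S \<subseteq> (\<lambda>i. s * turn \<sigma> n i) ` {0..<int n}" "card S = k"
  obtains m where "(\<Sum>i<k. cmod (s * turn \<sigma> n (m + int i) - y)) \<le> (\<Sum>p\<in>S. cmod (p - y))"
proof -
  let ?P = "\<lambda>i. s * turn \<sigma> n i"
  let ?C = "?P ` {0..<int n}"
  have CC: "?C = ?P ` {m..<m + int n}" for m
    using turn_image_window[OF n \<sigma>, of 0] turn_image_window[OF n \<sigma>, of m]
    by (simp add: image_image[of "(*) s" "turn \<sigma> n", symmetric])
  have kn: "k \<le> n"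
    using card_mono[OF _ S(1)] card_image_le[of "{0..<int n}" ?P] S(2) by simp
  define \<theta> \<psi> where "\<theta> = Arg s" "\<psi> = Arg y"
  define r \<rho> where "r = cmod s" "\<rho> = cmod y"
  have pol: "s = rcis r \<theta>" "y = rcis \<rho> \<psi>"
    by (simp_all add: \<theta>_\<psi>_def r_\<rho>_def rcis_cmod_Arg)
  \<comment> \<open>\<open>t\<close> is the real-valued position at which the direction of y lies.
    Rounding \<open>t - k/2\<close> up gives a window of k positions inside the interval from
    \<open>t - k/2\<close> to \<open>t + k/2\<close>.\<close>
  define t where "t = \<sigma> * (\<psi> - \<theta>) * real n / (2 * pi)"
  define m where "m = \<lceil>t - real k / 2\<rceil>"
  have m: "t - real k / 2 \<le> of_int m" "of_int m < t - real k / 2 + 1"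
    unfolding m_def by linarith+
  define h where "h c = sqrt (r\<^sup>2 + \<rho>\<^sup>2 - 2 * r * \<rho> * c)" for c
  have h_mono: "h c \<le> h c'" if "c' \<le> c" for c c'
    unfolding h_def using that by (auto intro!: mult_left_mono simp: r_\<rho>_def)
  have dist: "cmod (?P i - y) = h (cos (2 * pi * (of_int i - t) / real n))" for i
  proof -
    have "cos (\<theta> + \<sigma> * 2 * pi * of_int i / real n - \<psi>) = cos (\<sigma> * (2 * pi * (of_int i - t) / real n))"
      using \<sigma> n by (intro arg_cong[of _ _ cos]) (auto simp: t_def field_simps)
    also have "\<dots> = cos (2 * pi * (of_int i - t) / real n)" using \<sigma> by auto
    finally show ?thesis
      unfolding turn_def norm_diff_polar[OF pol] h_def by simp
  qed
  \<comment> \<open>an angle at least as large as those inside the arc and at most as large as those outside\<close>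
  let ?x = "pi * real k / real n"
  have x: "0 \<le> ?x" "?x \<le> pi" using kn n by (auto simp: field_simps)
  let ?W = "?P ` {m..<m + int k}"
  have inj: "inj_on ?P {m..<m + int k}"
    using turn_inj_on_window[OF n \<sigma> kn, of m] s by (auto simp: inj_on_def)
  have "(\<Sum>p\<in>?W. cmod (p - y)) \<le> (\<Sum>p\<in>S. cmod (p - y))"
  proof (rule sum_le_sum_of_threshold[where C = ?C and d = "h (cos ?x)"])
    show "?W \<subseteq> ?C" using kn by (subst CC[of m]) (intro image_mono, auto)
    show "card S = card ?W" using card_image[OF inj] S(2) by simp
  next
    fix p assume "p \<in> ?W"
    then obtain i where i: "p = ?P i" "i \<in> {m..<m + int k}" by (rule imageE)
    then have "m \<le> i" "i < m + int k" by auto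
    then have "of_int m \<le> real_of_int i" "real_of_int i + 1 \<le> of_int m + real k" by linarith+
    then have "\<bar>of_int i - t\<bar> \<le> real k / 2" using m by linarith
    then have "2 * pi * \<bar>of_int i - t\<bar> \<le> pi * real k" by simp
    then have "\<bar>2 * pi * (of_int i - t) / real n\<bar> \<le> ?x"
      using n by (simp add: abs_mult divide_right_mono)
    then show "cmod (p - y) \<le> h (cos ?x)"
      unfolding i(1) dist using x by (intro h_mono cos_ge_cos_of_abs_le)
  next
    fix p assume "p \<in> ?C - ?W"
    \<comment> \<open>With the circle cut at \<open>m\<close>, the points outside the arc occupy one
      interval of positions, so their angles from the direction of y lie between \<open>?x\<close>
      and \<open>2 * pi - ?x\<close>.\<close>
    then obtain i where i: "p = ?P i" "m + int k \<le> i" "i < m + int n"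
      unfolding CC[of m] by force
    then have "of_int m + real k \<le> real_of_int i" "real_of_int i + 1 \<le> of_int m + real n" by linarith+
    then have "real k / 2 \<le> of_int i - t" "of_int i - t \<le> real n - real k / 2" using m by linarith+
    then have "real k \<le> 2 * (of_int i - t)" "2 * (of_int i - t) \<le> 2 * real n - real k" by auto
    then have "pi * real k \<le> pi * (2 * (of_int i - t))" "pi * (2 * (of_int i - t)) \<le> pi * (2 * real n - real k)"
      by simp_all
    then have "?x \<le> pi * (2 * (of_int i - t)) / real n"
      "pi * (2 * (of_int i - t)) / real n \<le> pi * (2 * real n - real k) / real n"
      by (intro divide_right_mono; simp)+
    moreover have "pi * (2 * real n - real k) / real n = 2 * pi - ?x" using n by (simp add: field_simps)
    ultimately have "?x \<le> 2 * pi * (of_int i - t) / real n" "2 * pi * (of_int i - t) / real n \<le> 2 * pi - ?x"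
      by (simp_all add: mult_ac)
    then show "h (cos ?x) \<le> cmod (p - y)"
      unfolding i(1) dist using x by (intro h_mono cos_le_cos_of_between)
  qed (use S in auto)
  also have "(\<Sum>p\<in>?W. cmod (p - y)) = (\<Sum>i\<in>{m..<m + int k}. cmod (?P i - y))"
    using inj by (simp add: sum.reindex)
  also have "\<dots> = (\<Sum>i<k. cmod (?P (m + int i) - y))"
    by (rule sum.reindex_bij_witness[of _ "\<lambda>i. m + int i" "\<lambda>i. nat (i - m)"]) auto
  finally show ?thesis using that by blast
qed

text \<open>Price of the group at positions 0 to k - 1 served from \<open>y\<close>, with the sink
  at the origin: the source edges have load 1, the edge to the sink has load k, hence the factor
  \<open>real k powr \<alpha>\<close>.\<close>

definition arc_cost :: "complex \<Rightarrow> real \<Rightarrow> nat \<Rightarrow> real \<Rightarrow> nat \<Rightarrow> complex \<Rightarrow> real" where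
  "arc_cost s \<sigma> n \<alpha> k y = (\<Sum>i<k. cmod (s * turn \<sigma> n (int i) - y)) + real k powr \<alpha> * cmod y"

text \<open>A rotation about the sink preserves all distances involved, so an arc starting at
  \<open>m\<close> has the price of the arc starting at 0 when its Steiner point is rotated with
  it.\<close>

lemma arc_cost_rotate:
  "(\<Sum>i<k. cmod (s * turn \<sigma> n (m + int i) - y * turn \<sigma> n m)) + real k powr \<alpha> * cmod y =
   arc_cost s \<sigma> n \<alpha> k y"
proof -
  have "cmod (s * turn \<sigma> n (m + int i) - y * turn \<sigma> n m) = cmod (s * turn \<sigma> n (int i) - y)" for i
  proof -
    have "s * turn \<sigma> n (m + int i) - y * turn \<sigma> n m = turn \<sigma> n m * (s * turn \<sigma> n (int i) - y)"
      by (simp add: turn_add algebra_simps)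
    then show ?thesis by (simp add: norm_mult)
  qed
  then show ?thesis by (simp add: arc_cost_def)
qed

text \<open>The arc nearest to \<open>y\<close> replaces the group without raising the cost; turning
  that arc back to position 0 takes \<open>y\<close> along and keeps its distance to the
  sink.\<close>

lemma arc_cost_le_group_cost:
  assumes "n \<ge> 1" "\<sigma> = 1 \<or> \<sigma> = -1" "s \<noteq> 0"
    and "S \<subseteq> (\<lambda>i. s * turn \<sigma> n i) ` {0..<int n}" "card S = k"
  obtains y' where "arc_cost s \<sigma> n \<alpha> k y' \<le> (\<Sum>p\<in>S. cmod (p - y)) + real k powr \<alpha> * cmod y"
proof -
  obtain m where m: "(\<Sum>i<k. cmod (s * turn \<sigma> n (m + int i) - y)) \<le> (\<Sum>p\<in>S. cmod (p - y))"
    using consecutive_arc_closest[OF assms] by blast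
  have "y * turn \<sigma> n (- m) * turn \<sigma> n m = y"
    using turn_add[of \<sigma> n "-m" m] by (simp add: mult.assoc)
  moreover have "cmod (y * turn \<sigma> n (- m)) = cmod y" by (simp add: norm_mult)
  ultimately have "arc_cost s \<sigma> n \<alpha> k (y * turn \<sigma> n (- m)) =
      (\<Sum>i<k. cmod (s * turn \<sigma> n (m + int i) - y)) + real k powr \<alpha> * cmod y"
    by (metis arc_cost_rotate)
  then show ?thesis using m that[of "y * turn \<sigma> n (- m)"] by linarith
qed

lemma sum_turn_eq_0:
  assumes "n \<ge> 2" "\<sigma> = 1 \<or> \<sigma> = -1"
  shows "(\<Sum>i<n. turn \<sigma> n (int i)) = 0"
proof -
  have "turn \<sigma> n 1 \<noteq> 1" using turn_eq_1_imp_dvd[of n \<sigma> 1] assms by auto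
  moreover have "turn \<sigma> n 1 ^ n = 1"
    using turn_period[of n \<sigma> 0 1] assms by (simp add: turn_power)
  ultimately show ?thesis
    by (simp add: turn_power[symmetric] geometric_sum)
qed

text \<open>Each distance \<open>\<bar>p - y\<bar>\<close> is at least the length of the projection of \<open>p - y\<close> on the direction
  of \<open>p\<close>, and the projections of \<open>y\<close> cancel.\<close>

lemma sum_dist_full_circle:
  assumes "n \<ge> 2" "\<sigma> = 1 \<or> \<sigma> = -1"
  shows "real n * cmod s \<le> (\<Sum>i<n. cmod (s * turn \<sigma> n (int i) - y))"
proof (cases "s = 0")
  case False
  define u where "u i = sgn s * turn \<sigma> n (int i)" for i
  have u: "cmod (u i) = 1" "s * turn \<sigma> n (int i) = cmod s * u i" for i
    using False by (auto simp: u_def norm_mult norm_sgn) (auto simp: sgn_eq)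
  have "cmod s - Re (y * cnj (u i)) \<le> cmod (s * turn \<sigma> n (int i) - y)" for i
  proof -
    have "u i * cnj (u i) = 1" using u(1)[of i] by (simp add: complex_norm_square[symmetric])
    then have "(s * turn \<sigma> n (int i) - y) * cnj (u i) = cmod s - y * cnj (u i)"
      by (simp add: u(2) algebra_simps)
    then have "cmod s - Re (y * cnj (u i)) = Re ((s * turn \<sigma> n (int i) - y) * cnj (u i))" by simp
    also have "\<dots> \<le> cmod ((s * turn \<sigma> n (int i) - y) * cnj (u i))" by (rule complex_Re_le_cmod)
    finally show ?thesis by (simp add: norm_mult u)
  qed
  then have "(\<Sum>i<n. cmod s - Re (y * cnj (u i))) \<le> (\<Sum>i<n. cmod (s * turn \<sigma> n (int i) - y))"
    by (intro sum_mono)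
  moreover have "(\<Sum>i<n. cmod s - Re (y * cnj (u i))) = real n * cmod s - Re (y * cnj (\<Sum>i<n. u i))"
    by (simp add: sum_subtractf sum_distrib_left)
  moreover have "(\<Sum>i<n. u i) = 0"
    using sum_turn_eq_0[OF assms] by (simp add: u_def sum_distrib_left[symmetric])
  ultimately show ?thesis by simp
qed (auto intro: sum_nonneg)

lemma arc_cost_center: "arc_cost s \<sigma> n \<alpha> k 0 = real k * cmod s"
  by (simp add: arc_cost_def norm_mult)

lemma arc_cost_nonneg: "0 \<le> arc_cost s \<sigma> n \<alpha> k y"
  by (simp add: arc_cost_def sum_nonneg)

text \<open>These are the two sizes priced without the solver. For k = 1 the triangle inequality
  suffices; for k = n the full-circle bound already holds for the source edges alone.\<close>

lemma arc_cost_center_le: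
  assumes "n \<ge> 1" "\<sigma> = 1 \<or> \<sigma> = -1" "k = 1 \<or> k = n"
  shows "arc_cost s \<sigma> n \<alpha> k 0 \<le> arc_cost s \<sigma> n \<alpha> k y"
proof (cases "k = 1")
  case True
  have "cmod s \<le> cmod (s - y) + cmod y" using norm_triangle_ineq[of "s - y" y] by simp
  then show ?thesis using True by (simp add: arc_cost_def)
next
  case False
  then have "real n * cmod s \<le> (\<Sum>i<n. cmod (s * turn \<sigma> n (int i) - y))"
    using assms by (intro sum_dist_full_circle) auto
  also have "\<dots> \<le> (\<Sum>i<n. cmod (s * turn \<sigma> n (int i) - y)) + real n powr \<alpha> * cmod y" by simp
  finally show ?thesis using False assms unfolding arc_cost_center by (auto simp: arc_cost_def)
qed

text \<open>The inner product of two points of the circle is governed by the cosine of their angle, so its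
  maximum over the other sources is attained at a neighbour.\<close>

lemma max_inner_product_imp_neighbour:
  fixes Z :: "nat \<Rightarrow> complex"
  assumes n: "n \<ge> 2" and r: "r > 0"
    and Z: "Z ` {..<n} = (\<lambda>i. rcis r (\<theta> + 2 * pi * real i / real n)) ` {..<n}"
    and j: "1 \<le> j" "j < n"
    and max: "\<And>i. 1 \<le> i \<Longrightarrow> i < n \<Longrightarrow> Re (Z i * cnj (Z 0)) \<le> Re (Z j * cnj (Z 0))"
  shows "Z j / Z 0 = turn 1 n 1 \<or> Z j / Z 0 = turn (-1) n 1"
proof -
  let ?c = "rcis r \<theta>"
  have rc: "rcis r (\<theta> + 2 * pi * real i / real n) = ?c * turn 1 n (int i)" for i
    by (simp add: rcis_def turn_def cis_mult)
  have Z': "Z ` {..<n} = (\<lambda>i. ?c * turn 1 n (int i)) ` {..<n}" using Z by (simp add: rc)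
  have injt: "inj_on (\<lambda>i. ?c * turn 1 n (int i)) {..<n}"
  proof (rule inj_onI)
    fix x y assume xy: "x \<in> {..<n}" "y \<in> {..<n}" "?c * turn 1 n (int x) = ?c * turn 1 n (int y)"
    have "turn 1 n (int x) = turn 1 n (int y)" using xy(3) r by simp
    then show "x = y"
      using turn_inj_on_window[of n 1 n 0] n xy(1,2) by (force simp: inj_on_def)
  qed
  have injZ: "inj_on Z {..<n}"
    using Z' card_image[OF injt] by (intro eq_card_imp_inj_on) auto
  obtain a where a: "a < n" "Z 0 = ?c * turn 1 n (int a)" using Z' n by force
  have Z0: "Z 0 \<noteq> 0" using a r norm_turn[of 1 n "int a"] by (auto simp del: norm_turn)
  have nZ: "cmod (Z 0) = r" using a r by (simp add: norm_mult)
  have quot: "\<exists>d. int b - int a = d \<and> Z i = Z 0 * turn 1 n d" if "Z i = ?c * turn 1 n (int b)" for i b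
    using that a(2) turn_add[of 1 n "int a" "int b - int a"] by (simp add: mult.assoc)
  have inner: "Re (Z 0 * turn 1 n d * cnj (Z 0)) = r\<^sup>2 * cos (2 * pi * of_int d / real n)" for d
  proof -
    have "Z 0 * turn 1 n d * cnj (Z 0) = of_real (r\<^sup>2) * turn 1 n d"
      using complex_norm_square[of "Z 0"] nZ by (simp add: mult.commute mult.left_commute)
    then show ?thesis by (simp only: Re_complex_of_real[symmetric] mult.commute[of "of_real _"]) (simp add: turn_def flip: of_real_power)
  qed
  obtain b where b: "b < n" "Z j = ?c * turn 1 n (int b)" using Z' j by force
  obtain d where d: "d = int b - int a" "Z j = Z 0 * turn 1 n d" using quot[OF b(2)] by blast
  have "a \<noteq> b" using inj_onD[OF injZ, of 0 j] a b j n by force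
  then have d0: "d \<noteq> 0" "\<bar>d\<bar> < int n" using d a b by auto
  \<comment> \<open>The nonzero offset \<open>d\<close> is below n in absolute value, so its angle
    stays at least one step away from 0 and from a full turn.\<close>
  have upper: "cos (2 * pi * of_int d / real n) \<le> cos (2 * pi / real n)"
  proof -
    have "2 * pi * \<bar>of_int d\<bar> \<ge> 2 * pi * 1" "2 * pi * \<bar>of_int d\<bar> \<le> 2 * pi * (real n - 1)"
      using d0 by (auto intro!: mult_left_mono simp: abs_if)
    then have "cos (2 * pi * \<bar>of_int d\<bar> / real n) \<le> cos (2 * pi / real n)"
      using n by (intro cos_le_cos_of_between) (auto simp: field_simps)
    then show ?thesis by (cases "d \<ge> 0") auto
  qed
  \<comment> \<open>The position after that of source 0, taken modulo n, belongs to some source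
    other than source 0, and maximality compares source \<open>j\<close> with it.\<close>
  have lower: "cos (2 * pi / real n) \<le> cos (2 * pi * of_int d / real n)"
  proof -
    obtain e where e: "turn 1 n (int a + 1) = turn 1 n (int e)" "e < n"
      using turn_mod[of n 1 "int a + 1"] n that[of "nat ((int a + 1) mod int n)"]
      by (simp add: nat_less_iff)
    have "?c * turn 1 n (int e) \<in> Z ` {..<n}" unfolding Z' using e(2) by (intro imageI) simp
    then obtain i where i: "i < n" "Z i = ?c * turn 1 n (int e)" by force
    have Zi: "Z i = Z 0 * turn 1 n 1" using a(2) i(2) e(1) by (simp add: turn_add mult.assoc)
    have "turn 1 n 1 \<noteq> 1" using turn_eq_1_imp_dvd[of n 1 1] n by auto
    then have "i \<noteq> 0" using Zi Z0 by (intro notI) simp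
    then have "Re (Z i * cnj (Z 0)) \<le> Re (Z j * cnj (Z 0))" using max[of i] i(1) by linarith
    then have "r\<^sup>2 * cos (2 * pi / real n) \<le> r\<^sup>2 * cos (2 * pi * of_int d / real n)"
      using inner[of 1] inner[of d] unfolding Zi d(2) by simp
    then show ?thesis using r by simp
  qed
  have c: "cos (2 * pi * of_int d / real n) = cos (2 * pi / real n)" using upper lower by simp
  \<comment> \<open>Equal cosines determine the sine up to sign, and the two signs are the two
    neighbours.\<close>
  then have "(sin (2 * pi * of_int d / real n))\<^sup>2 = (sin (2 * pi / real n))\<^sup>2"
    by (simp add: sin_squared_eq)
  then have "sin (2 * pi * of_int d / real n) = sin (2 * pi / real n) \<or>
      sin (2 * pi * of_int d / real n) = - sin (2 * pi / real n)" by (simp add: power2_eq_iff)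
  then have "turn 1 n d = turn 1 n 1 \<or> turn 1 n d = turn (-1) n 1"
    using c by (auto simp: turn_def complex_eq_iff)
  then show ?thesis using d(2) Z0 by auto
qed

text \<open>The points form a coset of the group of n-th roots of unity. Any of its elements
  represents the coset, and reversing the orientation permutes the group, so the unknown phase
  \<theta> can be replaced by source 0.\<close>

lemma equally_spaced_eq_orbit:
  fixes Z :: "nat \<Rightarrow> complex"
  assumes n: "n \<ge> 1" and \<sigma>: "\<sigma> = 1 \<or> \<sigma> = -1"
    and Z: "Z ` {..<n} = (\<lambda>i. rcis r (\<theta> + 2 * pi * real i / real n)) ` {..<n}"
  shows "Z ` {..<n} = (\<lambda>i. Z 0 * turn \<sigma> n i) ` {0..<int n}"
proof -
  let ?c = "rcis r \<theta>"
  have rc: "rcis r (\<theta> + 2 * pi * real i / real n) = ?c * turn 1 n (int i)" for i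
    by (simp add: rcis_def turn_def cis_mult)
  have I: "int ` {..<n} = {0..<int n}"
    by (auto simp: image_def) (metis lessThan_iff nat_0_le nat_less_iff zless_nat_eq_int_zless)
  have rng: "range (turn \<sigma> n) = range (turn 1 n)"
    using \<sigma> by (auto simp: turn_uminus_eq image_def) (metis minus_minus)
  have "Z ` {..<n} = (\<lambda>i. ?c * turn 1 n i) ` int ` {..<n}" using Z by (simp add: rc image_image)
  also have "\<dots> = (*) ?c ` range (turn 1 n)"
    using turn_image_window[of n 1 0] n by (simp add: I image_image[of "(*) ?c" "turn 1 n", symmetric])
  finally have ZR: "Z ` {..<n} = (*) ?c ` range (turn 1 n)" .
  have "Z 0 \<in> Z ` {..<n}" using n by simp
  then obtain a where a: "Z 0 = ?c * turn 1 n a" unfolding ZR by auto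
  have "(*) ?c ` range (turn 1 n) = (*) (Z 0) ` range (turn 1 n)"
  proof -
    have "?c * turn 1 n i = Z 0 * turn 1 n (i - a)" for i
      using turn_add[of 1 n a "i - a"] by (simp add: a mult.assoc)
    then have "?c * turn 1 n i \<in> (*) (Z 0) ` range (turn 1 n)" for i by (metis imageI rangeI)
    moreover have "Z 0 * turn 1 n i = ?c * turn 1 n (a + i)" for i
      by (simp add: a turn_add mult.assoc)
    then have "Z 0 * turn 1 n i \<in> (*) ?c ` range (turn 1 n)" for i by (metis imageI rangeI)
    ultimately show ?thesis by blast
  qed
  also have "\<dots> = (*) (Z 0) ` turn \<sigma> n ` {0..<int n}"
    using turn_image_window[OF n \<sigma>, of 0] by (simp add: rng)
  finally show ?thesis using ZR by (simp add: image_image)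
qed

section \<open>Layouts with one intermediate layer and one sink\<close>

text \<open>The children of the sink, be they Steiner vertices or sources attached directly; each
  one stands for a group.\<close>

definition hubs :: "layout \<Rightarrow> vertex set" where
  "hubs L = {v. (v, Sink 0) \<in> edges L}"

definition subtree_sources :: "flamecast \<Rightarrow> layout \<Rightarrow> vertex \<Rightarrow> nat set" where
  "subtree_sources I L v = {i. i < length (sources I) \<and> (Source i, v) \<in> (edges L)\<^sup>*}"

lemma load_eq_card_subtree_sources: "load I L v = card (subtree_sources I L v)"
proof -
  have "{u \<in> source_vertices I. (u, v) \<in> (edges L)\<^sup>*} = Source ` subtree_sources I L v"
    by (auto simp: source_vertices_def subtree_sources_def)
  then show ?thesis by (simp add: load_def card_image inj_on_def)
qed

text \<open>A finite acyclic relation has a well-founded converse, so climbing from child to parent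
  terminates.\<close>

lemma rooted_forest_reaches_root:
  assumes "rooted_forest L" "v \<in> verts L"
  obtains r where "r \<in> roots L" "(v, r) \<in> (edges L)\<^sup>*"
proof -
  have "finite (edges L)"
    using assms(1) finite_subset[of "edges L" "verts L \<times> verts L"] by (auto simp: rooted_forest_def)
  then have "wf ((edges L)\<inverse>)"
    using assms(1) by (auto simp: rooted_forest_def intro: finite_acyclic_wf_converse)
  then have "v \<in> verts L \<longrightarrow> (\<exists>r\<in>roots L. (v, r) \<in> (edges L)\<^sup>*)"
  proof (induction v rule: wf_induct_rule)
    case (less v)
    show ?case
    proof (cases "\<exists>u. (v, u) \<in> edges L")
      case True
      then obtain u where u: "(v, u) \<in> edges L" by blast
      then have "u \<in> verts L" using assms(1) by (auto simp: rooted_forest_def)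
      then show ?thesis using less u by (meson converseI converse_rtrancl_into_rtrancl)
    qed (auto simp: roots_def)
  qed
  then show ?thesis using assms(2) that by blast
qed

lemma layer_root: "v \<in> roots L \<Longrightarrow> layer L v = 0"
  unfolding layer_def by (rule Least_eq_0) auto

lemma layer_child_of_root:
  assumes "(v, r) \<in> edges L" "r \<in> roots L"
  shows "layer L v = 1"
  unfolding layer_def
proof (rule Least_equality)
  show "\<exists>r\<in>roots L. (v, r) \<in> edges L ^^ 1" using assms by auto
  fix k assume k: "\<exists>r\<in>roots L. (v, r) \<in> edges L ^^ k"
  have "v \<notin> roots L" using assms(1) by (auto simp: roots_def)
  then show "1 \<le> k" using k by (cases k) auto
qed

section \<open>The shape and the cost of a layout of height at most two\<close>

context
  fixes I :: flamecast and L :: layout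
  assumes top: "topology I L" and emb: "embedding I L"
    and one_layer: "num_layers I = 1" and one_sink: "length (sinks I) = 1"
    and sources_nonempty: "sources I \<noteq> []"
begin

lemma source_in_leaves: "i < length (sources I) \<Longrightarrow> Source i \<in> leaves L"
  using top by (auto simp: topology_def source_vertices_def)

lemma sink_in_roots: "Sink 0 \<in> roots L"
proof -
  have "Source 0 \<in> verts L" using source_in_leaves[of 0] sources_nonempty by (simp add: leaves_def)
  moreover have "rooted_forest L" using top by (simp add: topology_def)
  ultimately obtain r where "r \<in> roots L" using rooted_forest_reaches_root by blast
  moreover have "roots L \<subseteq> {Sink 0}"
    using top one_sink by (auto simp: topology_def sink_vertices_def)
  ultimately show ?thesis by auto
qed

lemma roots_eq: "roots L = {Sink 0}"
  using sink_in_roots top one_sink by (auto simp: topology_def sink_vertices_def)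

lemma sink_no_parent: "(Sink 0, v) \<notin> edges L"
  using sink_in_roots by (auto simp: roots_def)

lemma edges_in_verts: "(u, v) \<in> edges L \<Longrightarrow> u \<in> verts L \<and> v \<in> verts L"
  using top by (auto simp: topology_def rooted_forest_def)

lemma parent_unique: "(u, v) \<in> edges L \<Longrightarrow> (u, w) \<in> edges L \<Longrightarrow> v = w"
  using top by (auto simp: topology_def rooted_forest_def single_valued_def)

text \<open>Some root is reachable, so the minimum defining \<open>layer\<close> is attained and is
  the length of an actual path to the sink; the height bound limits it to two edges.\<close>

lemma vertex_depth:
  assumes "v \<in> verts L"
  shows "v = Sink 0 \<or> v \<in> hubs L \<or> (\<exists>u\<in>hubs L. (v, u) \<in> edges L)"
proof -
  have "rooted_forest L" using top by (simp add: topology_def)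
  then obtain r where "r \<in> roots L" "(v, r) \<in> (edges L)\<^sup>*"
    using rooted_forest_reaches_root assms by blast
  then have "\<exists>k. \<exists>r\<in>roots L. (v, r) \<in> edges L ^^ k" using rtrancl_imp_relpow by blast
  then have "(v, Sink 0) \<in> edges L ^^ layer L v"
    unfolding layer_def roots_eq using LeastI_ex[of "\<lambda>k. \<exists>r\<in>{Sink 0}. (v, r) \<in> edges L ^^ k"] by auto
  moreover have "layer L v \<le> 2" using top assms one_layer by (auto simp: topology_def)
  then have "layer L v = 0 \<or> layer L v = 1 \<or> layer L v = 2" by auto
  ultimately show ?thesis by (auto simp: hubs_def numeral_2_eq_2)
qed

lemma parent_sink_or_hub: "(u, v) \<in> edges L \<Longrightarrow> v = Sink 0 \<or> v \<in> hubs L"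
  using vertex_depth[of u] edges_in_verts[of u v] sink_no_parent parent_unique
  by (auto simp: hubs_def)

lemma sink_not_hub: "Sink 0 \<notin> hubs L"
  using sink_no_parent by (auto simp: hubs_def)

text \<open>Were there a vertex below such a child, the child would itself be a hub and its unique
  parent the sink. So the child is a leaf, and leaves are sources.\<close>

lemma child_of_hub_is_source:
  assumes "(u, v) \<in> edges L" "v \<in> hubs L"
  obtains i where "i < length (sources I)" "u = Source i"
proof -
  have "(w, u) \<notin> edges L" for w
    using parent_sink_or_hub[of w u] assms sink_no_parent parent_unique sink_not_hub
    by (auto simp: hubs_def)
  then have "u \<in> leaves L" using edges_in_verts assms by (auto simp: leaves_def)
  then show ?thesis using top that by (auto simp: topology_def source_vertices_def)
qed

lemma source_no_child: "i < length (sources I) \<Longrightarrow> (u, Source i) \<notin> edges L"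
  using source_in_leaves by (auto simp: leaves_def)

lemma hub_descendant_iff:
  assumes "v \<in> hubs L"
  shows "(u, v) \<in> (edges L)\<^sup>* \<longleftrightarrow> u = v \<or> (u, v) \<in> edges L"
proof
  assume "(u, v) \<in> (edges L)\<^sup>*"
  then show "u = v \<or> (u, v) \<in> edges L"
  proof (cases rule: rtranclE)
    case (step w)
    then obtain i where i: "i < length (sources I)" "w = Source i" using child_of_hub_is_source assms by blast
    from step(1) have "u = w"
      by (cases rule: rtranclE) (use i source_no_child in auto)
    then show ?thesis using step by simp
  qed simp
qed auto

text \<open>Either the hub is a source and has nothing below it, or it is no leaf and its children
  are precisely the sources of its group.\<close>

lemma hub_leaf_or_inner:
  assumes "v \<in> hubs L"
  obtains (leaf) i where "i < length (sources I)" "v = Source i" "subtree_sources I L v = {i}" "{u. (u, v) \<in> edges L} = {}"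
  | (inner) "{u. (u, v) \<in> edges L} = Source ` subtree_sources I L v" "subtree_sources I L v \<noteq> {}"
proof (cases "\<exists>i < length (sources I). v = Source i")
  case True
  then obtain i where i: "i < length (sources I)" "v = Source i" by blast
  have "{u. (u, v) \<in> edges L} = {}" using i source_no_child by auto
  moreover from this have "subtree_sources I L v = {i}"
    using hub_descendant_iff[OF assms] i by (auto simp: subtree_sources_def)
  ultimately show ?thesis using leaf i by blast
next
  case False
  then have *: "subtree_sources I L v = {i. i < length (sources I) \<and> (Source i, v) \<in> edges L}"
    using hub_descendant_iff[OF assms] by (auto simp: subtree_sources_def)
  then have eq: "{u. (u, v) \<in> edges L} = Source ` subtree_sources I L v"
    using child_of_hub_is_source[OF _ assms] by auto blast
  have "v \<in> verts L" using assms edges_in_verts by (auto simp: hubs_def)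
  moreover have "v \<notin> leaves L" using False top by (auto simp: topology_def source_vertices_def)
  ultimately have "{u. (u, v) \<in> edges L} \<noteq> {}" by (auto simp: leaves_def)
  then show ?thesis using inner eq by blast
qed

lemma subtree_sources_nonempty: "v \<in> hubs L \<Longrightarrow> subtree_sources I L v \<noteq> {}"
  by (cases rule: hub_leaf_or_inner) auto

lemma finite_hubs: "finite (hubs L)"
proof -
  have "hubs L \<subseteq> verts L" using edges_in_verts by (auto simp: hubs_def)
  moreover have "finite (verts L)" using top by (auto simp: topology_def rooted_forest_def)
  ultimately show ?thesis by (rule finite_subset)
qed

lemma Union_subtree_sources: "(\<Union>v\<in>hubs L. subtree_sources I L v) = {..<length (sources I)}"
proof -
  have "\<exists>v\<in>hubs L. (Source i, v) \<in> (edges L)\<^sup>*" if "i < length (sources I)" for i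
    using vertex_depth[of "Source i"] source_in_leaves[OF that] by (auto simp: leaves_def)
  then show ?thesis by (auto simp: subtree_sources_def)
qed

lemma disjoint_subtree_sources:
  assumes "v \<in> hubs L" "w \<in> hubs L" "v \<noteq> w"
  shows "subtree_sources I L v \<inter> subtree_sources I L w = {}"
proof -
  have "Sink 0 \<noteq> v" "Sink 0 \<noteq> w" using assms sink_not_hub by auto
  then show ?thesis
    using assms hub_descendant_iff[OF assms(1)] hub_descendant_iff[OF assms(2)] parent_unique
    by (auto simp: subtree_sources_def hubs_def)
qed

lemma sum_load_hubs: "(\<Sum>v\<in>hubs L. load I L v) = length (sources I)"
proof -
  have "(\<Sum>v\<in>hubs L. load I L v) = card (\<Union>v\<in>hubs L. subtree_sources I L v)"
    unfolding load_eq_card_subtree_sources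
    by (rule card_UN_disjoint[symmetric])
      (use finite_hubs disjoint_subtree_sources in \<open>auto simp: subtree_sources_def\<close>)
  then show ?thesis by (simp add: Union_subtree_sources)
qed

lemma load_source:
  assumes "i < length (sources I)"
  shows "load I L (Source i) = 1"
proof -
  have "(Source j, Source i) \<in> (edges L)\<^sup>* \<longleftrightarrow> j = i" for j
    by (auto elim: rtranclE simp: source_no_child[OF assms])
  then have "subtree_sources I L (Source i) = {i}" using assms by (auto simp: subtree_sources_def)
  then show ?thesis by (simp add: load_eq_card_subtree_sources)
qed

lemma load_sink: "load I L (Sink 0) = length (sources I)"
proof -
  have "(Source i, Sink 0) \<in> (edges L)\<^sup>*" if i: "i < length (sources I)" for i
  proof -
    have "Source i \<in> verts L" using source_in_leaves[OF i] by (simp add: leaves_def)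
    from vertex_depth[OF this] show ?thesis
      by (auto simp: hubs_def intro: converse_rtrancl_into_rtrancl)
  qed
  then have "subtree_sources I L (Sink 0) = {..<length (sources I)}" by (auto simp: subtree_sources_def)
  then show ?thesis by (simp add: load_eq_card_subtree_sources)
qed

text \<open>A source attached directly to the sink fits the same formula, as a group served from its own position.\<close>

lemma layout_cost_eq_sum_hubs:
  "layout_cost I L = (\<Sum>v\<in>hubs L. (\<Sum>i\<in>subtree_sources I L v. dist (sources I ! i) (pos L v)) +
     real (load I L v) powr alpha I * dist (pos L v) (sinks I ! 0))"
proof -
  let ?f = "\<lambda>u v. dist (pos L u) (pos L v) * real (load I L u) powr alpha I"
  have posS: "pos L (Source i) = sources I ! i" if "i < length (sources I)" for i
    using that emb source_in_leaves by (auto simp: embedding_def leaves_def)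
  have posT: "pos L (Sink 0) = sinks I ! 0"
    using emb sink_in_roots by (auto simp: embedding_def roots_def)
  \<comment> \<open>Edges are split by their parent, sink or hub. The two families are disjoint
    because the sink is not a hub.\<close>
  have E: "edges L = (\<lambda>v. (v, Sink 0)) ` hubs L \<union> (\<lambda>(v, u). (u, v)) ` (SIGMA v:hubs L. {u. (u, v) \<in> edges L})"
    (is "_ = ?A \<union> ?B")
  proof (intro set_eqI iffI)
    fix e assume e: "e \<in> edges L"
    obtain u v where uv: "e = (u, v)" by (cases e)
    with e parent_sink_or_hub[of u v] show "e \<in> ?A \<union> ?B" by (auto simp: hubs_def)
  qed (auto simp: hubs_def)
  have fin: "finite {u. (u, v) \<in> edges L}" for v
  proof (rule finite_subset)
    show "{u. (u, v) \<in> edges L} \<subseteq> verts L" using edges_in_verts by auto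
    show "finite (verts L)" using top by (auto simp: topology_def rooted_forest_def)
  qed
  have "layout_cost I L = (\<Sum>(u, v)\<in>(\<lambda>v. (v, Sink 0)) ` hubs L. ?f u v) +
      (\<Sum>(u, v)\<in>(\<lambda>(v, u). (u, v)) ` (SIGMA v:hubs L. {u. (u, v) \<in> edges L}). ?f u v)"
    unfolding layout_cost_def
    by (subst E, rule sum.union_disjoint) (use finite_hubs fin sink_not_hub in \<open>auto intro!: finite_imageI finite_SigmaI\<close>)
  also have "(\<Sum>(u, v)\<in>(\<lambda>v. (v, Sink 0)) ` hubs L. ?f u v) = (\<Sum>v\<in>hubs L. ?f v (Sink 0))"
    by (subst sum.reindex) (auto simp: inj_on_def)
  also have "(\<Sum>(u, v)\<in>(\<lambda>(v, u). (u, v)) ` (SIGMA v:hubs L. {u. (u, v) \<in> edges L}). ?f u v) =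
      (\<Sum>v\<in>hubs L. \<Sum>u | (u, v) \<in> edges L. ?f u v)"
    using finite_hubs fin by (subst sum.reindex) (auto simp: inj_on_def sum.Sigma o_def split_def)
  also have "(\<Sum>v\<in>hubs L. ?f v (Sink 0)) + \<dots> = (\<Sum>v\<in>hubs L. ?f v (Sink 0) + (\<Sum>u | (u, v) \<in> edges L. ?f u v))"
    by (simp add: sum.distrib)
  also have "\<dots> = (\<Sum>v\<in>hubs L. (\<Sum>i\<in>subtree_sources I L v. dist (sources I ! i) (pos L v)) +
      real (load I L v) powr alpha I * dist (pos L v) (sinks I ! 0))"
  proof (rule sum.cong[OF refl])
    fix v assume v: "v \<in> hubs L"
    have "(\<Sum>u | (u, v) \<in> edges L. ?f u v) = (\<Sum>i\<in>subtree_sources I L v. dist (sources I ! i) (pos L v))"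
      using v
    proof (cases rule: hub_leaf_or_inner)
      case (leaf i)
      \<comment> \<open>No edge enters the hub, and its only source lies at the hub itself, so both
        sides are 0.\<close>
      then show ?thesis by (simp add: posS)
    next
      case inner
      have "(\<Sum>u\<in>Source ` subtree_sources I L v. ?f u v) = (\<Sum>i\<in>subtree_sources I L v. ?f (Source i) v)"
        by (subst sum.reindex) (auto simp: inj_on_def)
      also have "\<dots> = (\<Sum>i\<in>subtree_sources I L v. dist (sources I ! i) (pos L v))"
        by (rule sum.cong) (auto simp: subtree_sources_def posS load_source)
      finally show ?thesis by (simp add: inner)
    qed
    then show "?f v (Sink 0) + (\<Sum>u | (u, v) \<in> edges L. ?f u v) =
        (\<Sum>i\<in>subtree_sources I L v. dist (sources I ! i) (pos L v)) +
        real (load I L v) powr alpha I * dist (pos L v) (sinks I ! 0)"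
      by (simp add: posT mult.commute)
  qed
  finally show ?thesis .
qed

end

section \<open>Layouts in which every group has its own Steiner vertex\<close>

definition star_edges :: "nat \<Rightarrow> nat \<Rightarrow> (nat \<Rightarrow> nat) \<Rightarrow> (vertex \<times> vertex) set" where
  "star_edges n q par = (\<lambda>j. (Source j, Steiner (par j))) ` {..<n} \<union> (\<lambda>a. (Steiner a, Sink 0)) ` {..<q}"

text \<open>That \<open>par\<close> is onto \<open>{..<q}\<close> says two things: every parent
  exists, and no Steiner vertex is a leaf, which the condition on leaves would forbid.\<close>

lemma star_layout_topology:
  assumes one_layer: "num_layers I = 1" and one_sink: "length (sinks I) = 1"
    and ne: "sources I \<noteq> []" and n: "n = length (sources I)"
    and par: "par ` {..<n} = {..<q}"
    and L: "edges L = star_edges n q par" "verts L = Field (star_edges n q par)"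
  shows "topology I L" "hubs L = Steiner ` {..<q}"
    "\<And>a. subtree_sources I L (Steiner a) = {j. j < n \<and> par j = a}"
    "\<And>j. j < n \<Longrightarrow> layer L (Source j) = 2"
    "verts L = Source ` {..<n} \<union> Steiner ` {..<q} \<union> {Sink 0}"
proof -
  let ?E = "star_edges n q par"
  have lt: "par j < q" if "j < n" for j using that par by auto
  have n0: "0 < n" using ne n by simp
  then have q0: "0 < q" using lt by fastforce
  show V: "verts L = Source ` {..<n} \<union> Steiner ` {..<q} \<union> {Sink 0}"
    unfolding L star_edges_def Field_def using lt q0 by auto
  have roots: "roots L = {Sink 0}"
    unfolding roots_def V L star_edges_def by auto
  have leaves: "leaves L = source_vertices I"
  proof -
    have "\<exists>j<n. par j = a" if "a < q" for a
    proof -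
      have "a \<in> par ` {..<n}" using that by (simp add: par)
      then show ?thesis by auto
    qed
    then have "\<exists>u. (u, Steiner a) \<in> edges L" if "a < q" for a
      using that unfolding L star_edges_def by blast
    moreover have "(Steiner 0, Sink 0) \<in> edges L" unfolding L star_edges_def using q0 by simp
    moreover have "(u, Source j) \<notin> edges L" for u j unfolding L star_edges_def by auto
    ultimately show ?thesis
      unfolding leaves_def V source_vertices_def n[symmetric] by blast
  qed
  show hubs: "hubs L = Steiner ` {..<q}"
    unfolding hubs_def L star_edges_def by auto
  have layer2: "layer L (Source j) = 2" if j: "j < n" for j
    unfolding layer_def roots
  proof (rule Least_equality)
    have "(Source j, Sink 0) \<in> ?E ^^ 2" using j lt[OF j] by (auto simp: numeral_2_eq_2 star_edges_def)
    then show "\<exists>r\<in>{Sink 0}. (Source j, r) \<in> edges L ^^ 2" by (simp add: L)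
    fix k assume k: "\<exists>r\<in>{Sink 0}. (Source j, r) \<in> edges L ^^ k"
    have "k \<noteq> 0" using k by (intro notI) simp
    moreover have "k \<noteq> 1" using k by (intro notI) (auto simp: L star_edges_def)
    ultimately show "2 \<le> k" by linarith
  qed
  then show "\<And>j. j < n \<Longrightarrow> layer L (Source j) = 2" .
  have layer1: "layer L (Steiner a) = 1" if "a < q" for a
    using that by (intro layer_child_of_root[of _ "Sink 0"]) (auto simp: roots L star_edges_def)
  have layer0: "layer L (Sink 0) = 0" by (simp add: layer_root roots)
  have acyc: "acyclic ?E"
  proof -
    \<comment> \<open>The intended layer of a vertex; it drops along every edge from child to parent
      and so excludes cycles.\<close>
    define h :: "vertex \<Rightarrow> nat" where "h v = (case v of Source i \<Rightarrow> 2 | Steiner a \<Rightarrow> 1 | Sink b \<Rightarrow> 0)" for v :: vertex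
    have "?E \<subseteq> (Wellfounded.measure h)\<inverse>" by (auto simp: star_edges_def h_def)
    moreover have "acyclic ((Wellfounded.measure h)\<inverse>)" by (simp add: wf_acyclic)
    ultimately show ?thesis using acyclic_subset by blast
  qed
  have "rooted_forest L"
    unfolding rooted_forest_def
  proof (intro conjI)
    show "finite (verts L)" by (simp add: V)
    show "edges L \<subseteq> verts L \<times> verts L" unfolding L by (auto simp: Field_def)
    show "single_valued (edges L)" unfolding L by (auto simp: single_valued_def star_edges_def)
    show "acyclic (edges L)" using acyc by (simp add: L)
  qed
  moreover have "layer L v \<le> num_layers I + 1" if "v \<in> verts L" for v
    using that layer0 layer1 layer2 one_layer unfolding V by auto
  moreover have "roots L \<subseteq> sink_vertices I" using one_sink by (auto simp: roots sink_vertices_def)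
  moreover have "verts L - leaves L - roots L \<subseteq> range Steiner"
    unfolding leaves roots V source_vertices_def n by auto
  ultimately show top: "topology I L" by (auto simp: topology_def leaves)
  show "subtree_sources I L (Steiner a) = {j. j < n \<and> par j = a}" for a
  proof -
    have "(Source j, Steiner a) \<in> ?E\<^sup>* \<longleftrightarrow> par j = a" if "j < n" for j
    proof
      assume "(Source j, Steiner a) \<in> ?E\<^sup>*"
      then show "par j = a"
      proof (cases rule: converse_rtranclE)
        case (step u)
        then have u: "u = Steiner (par j)" by (auto simp: star_edges_def)
        from step(2) show ?thesis
        proof (cases rule: rtranclE)
          case (step w)
          from step(2) obtain i where "w = Source i" by (auto simp: star_edges_def)
          with step(1) u show ?thesis by (auto elim: rtranclE simp: star_edges_def)
        qed (use u in simp)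
      qed simp
    next
      assume "par j = a"
      then show "(Source j, Steiner a) \<in> ?E\<^sup>*" using that by (auto simp: star_edges_def)
    qed
    then show ?thesis by (auto simp: subtree_sources_def L n)
  qed
qed

lemma star_layout_valid:
  assumes "num_layers I = 1" "length (sinks I) = 1" "sources I \<noteq> []" "n = length (sources I)"
    and "par ` {..<n} = {..<q}"
    and "edges L = star_edges n q par" "verts L = Field (star_edges n q par)"
    and emb: "embedding I L"
    and c: "1 \<le> capacities I ! 2" "\<And>a. a < q \<Longrightarrow> card {j. j < n \<and> par j = a} \<le> capacities I ! 1"
      "n \<le> capacities I ! 0"
  shows "valid_layout I L"
    and "layout_cost I L = (\<Sum>a<q. (\<Sum>j | j < n \<and> par j = a. dist (sources I ! j) (pos L (Steiner a))) +
      real (card {j. j < n \<and> par j = a}) powr alpha I * dist (pos L (Steiner a)) (sinks I ! 0))"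
proof -
  note star = star_layout_topology[OF assms(1-7)]
  note facts = star(1) emb assms(1-3)
  have "load I L v \<le> capacities I ! layer L v" if "v \<in> verts L" for v
  proof -
    consider j where "j < n" "v = Source j" | a where "a < q" "v = Steiner a" | "v = Sink 0"
      using \<open>v \<in> verts L\<close> unfolding star(5) by blast
    then show ?thesis
    proof cases
      case 1
      then show ?thesis using load_source[OF facts, of j] star(4)[of j] c(1) assms(4) by simp
    next
      case 2
      then have "layer L v = 1"
        using star(2) sink_in_roots[OF facts] by (intro layer_child_of_root[of _ "Sink 0"]) (auto simp: hubs_def)
      then show ?thesis using 2 c(2) star(3) by (simp add: load_eq_card_subtree_sources)
    next
      case 3
      then show ?thesis using load_sink[OF facts] layer_root sink_in_roots[OF facts] c(3) assms(4) by simp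
    qed
  qed
  then show "valid_layout I L" using star(1) emb by (auto simp: valid_layout_def)
  show "layout_cost I L = (\<Sum>a<q. (\<Sum>j | j < n \<and> par j = a. dist (sources I ! j) (pos L (Steiner a))) +
      real (card {j. j < n \<and> par j = a}) powr alpha I * dist (pos L (Steiner a)) (sinks I ! 0))"
    unfolding layout_cost_eq_sum_hubs[OF facts] star(2)
    by (subst sum.reindex) (auto simp: inj_on_def load_eq_card_subtree_sources star(3))
qed

section \<open>Timed program verification\<close>

abbreviation seq_com :: "com \<Rightarrow> com \<Rightarrow> com" (infixr \<open>;;\<close> 60) where
  "c ;; d \<equiv> SEQ c d"

abbreviation nvar :: "nat \<Rightarrow> nexp" where "nvar a \<equiv> NArr a (NConst 0)"
abbreviation rvar :: "nat \<Rightarrow> rexp" where "rvar a \<equiv> RArr a (NConst 0)"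

lemma nats_nset [simp]: "nats (nset a i x s) c = (if c = a then (nats s a)(i := x) else nats s c)"
  and reals_nset [simp]: "reals (nset a i x s) = reals s"
  and nats_rset [simp]: "nats (rset a i y s) = nats s"
  and reals_rset [simp]: "reals (rset a i y s) c = (if c = a then (reals s a)(i := y) else reals s c)"
  by (simp_all add: nset_def rset_def)

text \<open>Array names are literals, so the arrays that a program may write are known
  syntactically. One bound serves arrays of naturals and of reals; it is what lets the tables
  survive a call of an arbitrary solver.\<close>

primrec write_bound :: "com \<Rightarrow> nat" where
  "write_bound SKIP = 0"
| "write_bound (NASSIGN a e f) = Suc a"
| "write_bound (RASSIGN a e f) = Suc a"
| "write_bound (SEQ c d) = max (write_bound c) (write_bound d)"
| "write_bound (COND b c d) = max (write_bound c) (write_bound d)"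
| "write_bound (WHILE b c) = write_bound c"

lemma exec_frame:
  "exec c s t s' \<Longrightarrow> write_bound c \<le> a \<Longrightarrow> nats s' a = nats s a \<and> reals s' a = reals s a"
  by (induction rule: exec.induct) auto

definition runs :: "com \<Rightarrow> state \<Rightarrow> nat \<Rightarrow> (state \<Rightarrow> bool) \<Rightarrow> bool" where
  "runs c s t Q \<longleftrightarrow> (\<exists>u s'. exec c s u s' \<and> u \<le> t \<and> Q s')"

lemma runs_mono: "runs c s t Q \<Longrightarrow> t \<le> t' \<Longrightarrow> (\<And>s. Q s \<Longrightarrow> Q' s) \<Longrightarrow> runs c s t' Q'"
  unfolding runs_def by (meson le_trans)

lemma runs_SEQ:
  assumes "runs c s t P" "\<And>s. P s \<Longrightarrow> runs d s u Q"
  shows "runs (c ;; d) s (t + u) Q"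
  using assms unfolding runs_def by (meson add_le_mono exec_SEQ)

lemma runs_COND:
  assumes "bval b s \<Longrightarrow> runs c s t Q" "\<not> bval b s \<Longrightarrow> runs d s t Q"
  shows "runs (COND b c d) s (bcost b + t + 1) Q"
  using assms unfolding runs_def
  by (cases "bval b s") (meson add_le_mono order_refl exec_COND_True exec_COND_False)+

text \<open>On loop-free commands execution is a function and its time is bounded independently of the state;
  the values at \<open>WHILE\<close> are junk.\<close>

primrec loop_free :: "com \<Rightarrow> bool" where
  "loop_free SKIP = True"
| "loop_free (NASSIGN a e f) = True"
| "loop_free (RASSIGN a e f) = True"
| "loop_free (SEQ c d) = (loop_free c \<and> loop_free d)"
| "loop_free (COND b c d) = (loop_free c \<and> loop_free d)"
| "loop_free (WHILE b c) = False"

primrec result :: "com \<Rightarrow> state \<Rightarrow> state" where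
  "result SKIP s = s"
| "result (NASSIGN a e f) s = nset a (nval e s) (nval f s) s"
| "result (RASSIGN a e f) s = rset a (nval e s) (rval f s) s"
| "result (SEQ c d) s = result d (result c s)"
| "result (COND b c d) s = (if bval b s then result c s else result d s)"
| "result (WHILE b c) s = s"

primrec max_cost :: "com \<Rightarrow> nat" where
  "max_cost SKIP = 1"
| "max_cost (NASSIGN a e f) = ncost e + ncost f + 1"
| "max_cost (RASSIGN a e f) = ncost e + rcost f + 1"
| "max_cost (SEQ c d) = max_cost c + max_cost d"
| "max_cost (COND b c d) = bcost b + max (max_cost c) (max_cost d) + 1"
| "max_cost (WHILE b c) = 0"

lemma exec_loop_free: "loop_free c \<Longrightarrow> \<exists>t\<le>max_cost c. exec c s t (result c s)"
proof (induction c arbitrary: s)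
  case (SEQ c d)
  then obtain t u where "t \<le> max_cost c" "exec c s t (result c s)"
    "u \<le> max_cost d" "exec d (result c s) u (result d (result c s))" by fastforce
  then show ?case using exec_SEQ by (intro exI[of _ "t + u"]) auto
next
  case (COND b c d)
  show ?case
  proof (cases "bval b s")
    case True
    obtain t where t: "t \<le> max_cost c" "exec c s t (result c s)" using COND by fastforce
    then show ?thesis using True exec_COND_True[OF True t(2), of d]
      by (intro exI[of _ "bcost b + t + 1"]) auto
  next
    case False
    obtain t where t: "t \<le> max_cost d" "exec d s t (result d s)" using COND by fastforce
    then show ?thesis using False exec_COND_False[OF False t(2), of c]
      by (intro exI[of _ "bcost b + t + 1"]) auto
  qed
qed (auto intro: exec_SKIP exec_NASSIGN exec_RASSIGN simp del: One_nat_def)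

lemma runs_loop_free: "loop_free c \<Longrightarrow> Q (result c s) \<Longrightarrow> runs c s (max_cost c) Q"
  unfolding runs_def using exec_loop_free by blast

definition FOR :: "nat \<Rightarrow> nexp \<Rightarrow> nexp \<Rightarrow> com \<Rightarrow> com" where
  "FOR v lo hi c = NASSIGN v (NConst 0) lo ;;
     WHILE (NLess (nvar v) hi) (c ;; NASSIGN v (NConst 0) (NAdd (nvar v) (NConst 1)))"

text \<open>\<open>stable\<close> keeps the loop variable out of the invariant, so that incrementing
  it is harmless; the body must leave it unchanged. One pass adds at most 10 +
  \<open>ncost hi\<close> units for test and increment, which 20 covers, and the extra pass in the
  bound pays for initialisation and the final test.\<close>

lemma runs_FOR:
  assumes lo: "nval lo s = l" and le: "l \<le> h" and cost: "ncost lo + ncost hi \<le> 10"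
    and init: "Inv l s"
    and stable: "\<And>k s x. Inv k s \<Longrightarrow> Inv k (nset v 0 x s)"
    and hi: "\<And>k s. Inv k s \<Longrightarrow> nval hi s = h"
    and step: "\<And>k s. \<lbrakk>l \<le> k; k < h; Inv k s; nats s v 0 = k\<rbrakk> \<Longrightarrow>
      runs c s t (\<lambda>s'. Inv (Suc k) s' \<and> nats s' v 0 = k)"
  shows "runs (FOR v lo hi c) s ((h - l + 1) * (t + 20)) (Inv h)"
proof -
  let ?inc = "NASSIGN v (NConst 0) (NAdd (nvar v) (NConst 1))"
  let ?w = "WHILE (NLess (nvar v) hi) (c ;; ?inc)"
  have loop: "runs ?w s ((h - k) * (t + ncost hi + 10) + ncost hi + 4) (Inv h)"
    if "l \<le> k" "k \<le> h" "Inv k s" "nats s v 0 = k" for k s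
    using that
  proof (induction "h - k" arbitrary: k s)
    case 0
    then have "\<not> bval (NLess (nvar v) hi) s" using hi by auto
    from exec_WHILE_False[OF this, of "c ;; ?inc"] show ?case
      unfolding runs_def using 0 by (intro exI[of _ "ncost hi + 4"] exI[of _ s]) (auto simp: numeral_eq_Suc)
  next
    case (Suc d)
    then have kh: "k < h" by simp
    obtain u s1 where u: "exec c s u s1" "u \<le> t" "Inv (Suc k) s1" "nats s1 v 0 = k"
      using step[OF Suc.prems(1) kh Suc.prems(3,4)] by (auto simp: runs_def)
    define s2 where "s2 = nset v 0 (Suc k) s1"
    have "exec ?inc s1 6 s2"
      using exec_NASSIGN[of v "NConst 0" "NAdd (nvar v) (NConst 1)" s1] u(4)
      by (simp add: s2_def numeral_eq_Suc)
    then have body: "exec (c ;; ?inc) s (u + 6) s2" using u(1) exec_SEQ by blast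
    have "runs ?w s2 ((h - Suc k) * (t + ncost hi + 10) + ncost hi + 4) (Inv h)"
      by (rule Suc.hyps(1)) (use Suc.hyps(2) Suc.prems kh u stable in \<open>auto simp: s2_def\<close>)
    then obtain u' s' where u': "exec ?w s2 u' s'" "Inv h s'"
      "u' \<le> (h - Suc k) * (t + ncost hi + 10) + ncost hi + 4" by (auto simp: runs_def)
    have "bval (NLess (nvar v) hi) s" using hi Suc.prems kh by auto
    from exec_WHILE_True[OF this body u'(1)] have "exec ?w s (ncost hi + 4 + (u + 6) + u') s'"
      by (simp add: algebra_simps numeral_eq_Suc)
    moreover have "h - k = Suc (h - Suc k)" using kh by simp
    then have "(h - k) * (t + ncost hi + 10) = (h - Suc k) * (t + ncost hi + 10) + (t + ncost hi + 10)" by simp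
    then have "ncost hi + 4 + (u + 6) + u' \<le> (h - k) * (t + ncost hi + 10) + ncost hi + 4"
      using u'(3) u(2) by linarith
    ultimately show ?case unfolding runs_def using u'(2) by blast
  qed
  let ?s = "nset v 0 l s"
  have "runs (NASSIGN v (NConst 0) lo) s (ncost lo + 2) (\<lambda>s'. s' = ?s)"
    unfolding runs_def using exec_NASSIGN[of v "NConst 0" lo s] lo by force
  then have "runs (FOR v lo hi c) s (ncost lo + 2 + ((h - l) * (t + ncost hi + 10) + ncost hi + 4)) (Inv h)"
    unfolding FOR_def by (rule runs_SEQ) (use loop[of l ?s] le init stable in auto)
  then show ?thesis
  proof (rule runs_mono)
    have "(h - l) * (t + ncost hi + 10) \<le> (h - l) * (t + 20)" using cost by (intro mult_le_mono2) simp
    then show "ncost lo + 2 + ((h - l) * (t + ncost hi + 10) + ncost hi + 4) \<le> (h - l + 1) * (t + 20)"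
      using cost unfolding add_mult_distrib mult_1 by linarith
  qed
qed

section \<open>The algorithm\<close>

text \<open>All names from \<open>b + 10\<close> on are private to the algorithm when \<open>b\<close> bounds the arrays written by the
  Weber solver.\<close>

locale arrays =
  fixes b :: nat
begin

text \<open>The offset 10 also keeps clear of the arrays 0 to 6 used for input and output.\<close>

abbreviation "num \<equiv> b + 10"
abbreviation "cap \<equiv> b + 11"
abbreviation "kv \<equiv> b + 12"
abbreviation "iv \<equiv> b + 13"
abbreviation "jv \<equiv> b + 14"
abbreviation "choice \<equiv> b + 15"
abbreviation "next_start \<equiv> b + 16"
abbreviation "group_count \<equiv> b + 17"

abbreviation "eps \<equiv> b + 10"
abbreviation "alph \<equiv> b + 11"
abbreviation "sinkX \<equiv> b + 12"
abbreviation "sinkY \<equiv> b + 13"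
abbreviation "srcX \<equiv> b + 14"
abbreviation "srcY \<equiv> b + 15"
abbreviation "rotX \<equiv> b + 16"
abbreviation "rotY \<equiv> b + 17"
abbreviation "ptX \<equiv> b + 18"
abbreviation "ptY \<equiv> b + 19"
abbreviation "hubX \<equiv> b + 20"
abbreviation "hubY \<equiv> b + 21"
abbreviation "group_cost \<equiv> b + 22"
abbreviation "opt \<equiv> b + 23"
abbreviation "best \<equiv> b + 24"

text \<open>Everything is copied, since preparing and running the solver overwrites the input
  arrays. The sources are then stored relative to the sink, which becomes the origin.\<close>

definition read_scalars :: com where
  "read_scalars =
     NASSIGN num (NConst 0) (nvar 0) ;; NASSIGN cap (NConst 0) (NArr 1 (NConst 1)) ;;
     RASSIGN eps (NConst 0) (rvar 0) ;; RASSIGN alph (NConst 0) (RArr 0 (NConst 1)) ;;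
     RASSIGN sinkX (NConst 0) (rvar 3) ;; RASSIGN sinkY (NConst 0) (rvar 4)"

definition read_source :: com where
  "read_source =
     RASSIGN srcX (nvar iv) (RSub (RArr 1 (nvar iv)) (rvar sinkX)) ;;
     RASSIGN srcY (nvar iv) (RSub (RArr 2 (nvar iv)) (rvar sinkY))"

definition read_input :: com where
  "read_input = read_scalars ;; FOR iv (NConst 0) (nvar num) read_source"

text \<open>\<open>inner_src\<close> and \<open>cross_src\<close> are the real and imaginary part of
  source j times the conjugate of source 0; division by \<open>radius_sq\<close> yields the quotient
  of the two sources.\<close>

abbreviation inner_src :: rexp where
  "inner_src \<equiv> RAdd (RMul (rvar srcX) (RArr srcX (nvar jv))) (RMul (rvar srcY) (RArr srcY (nvar jv)))"

abbreviation cross_src :: rexp where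
  "cross_src \<equiv> RSub (RMul (rvar srcX) (RArr srcY (nvar jv))) (RMul (rvar srcY) (RArr srcX (nvar jv)))"

abbreviation radius_sq :: rexp where
  "radius_sq \<equiv> RAdd (RMul (rvar srcX) (rvar srcX)) (RMul (rvar srcY) (rvar srcY))"

text \<open>No inner product is below minus the squared radius, so starting from twice that value
  makes the first candidate win. The initial rotation 1 is kept only if there is a single source,
  for which it is correct.\<close>

definition init_rotation :: com where
  "init_rotation =
     RASSIGN rotX (NConst 0) (RNat (NConst 1)) ;; RASSIGN rotY (NConst 0) (RNat (NConst 0)) ;;
     RASSIGN best (NConst 0) (RSub (RNat (NConst 0)) (RMul (RNat (NConst 2)) radius_sq))"

definition improve_rotation :: com where
  "improve_rotation =
     COND (RLess (rvar best) inner_src)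
       (RASSIGN best (NConst 0) inner_src ;;
        RASSIGN rotX (NConst 0) (RDiv inner_src radius_sq) ;;
        RASSIGN rotY (NConst 0) (RDiv cross_src radius_sq))
       SKIP"

definition find_rotation :: com where
  "find_rotation = init_rotation ;; FOR jv (NConst 1) (nvar num) improve_rotation"

definition init_point :: com where
  "init_point = RASSIGN ptX (NConst 0) (rvar srcX) ;; RASSIGN ptY (NConst 0) (rvar srcY)"

definition next_point :: com where
  "next_point =
     RASSIGN ptX (NAdd (nvar iv) (NConst 1))
       (RSub (RMul (rvar rotX) (RArr ptX (nvar iv))) (RMul (rvar rotY) (RArr ptY (nvar iv)))) ;;
     RASSIGN ptY (NAdd (nvar iv) (NConst 1))
       (RAdd (RMul (rvar rotX) (RArr ptY (nvar iv))) (RMul (rvar rotY) (RArr ptX (nvar iv))))"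

definition list_points :: com where
  "list_points = init_point ;; FOR iv (NConst 0) (nvar num) next_point"

definition load_point :: com where
  "load_point =
     RASSIGN 1 (nvar iv) (RArr ptX (nvar iv)) ;; RASSIGN 2 (nvar iv) (RArr ptY (nvar iv)) ;;
     RASSIGN 3 (nvar iv) (RNat (NConst 1))"

text \<open>The sink enters as the point with index k, weighted by the load factor of the edge that
  leaves the Steiner point. Count and \<epsilon> are rewritten each time because an earlier call may
  have destroyed them.\<close>

definition load_center :: com where
  "load_center =
     RASSIGN 1 (nvar kv) (RNat (NConst 0)) ;; RASSIGN 2 (nvar kv) (RNat (NConst 0)) ;;
     RASSIGN 3 (nvar kv) (RPow (nvar kv) (rvar alph)) ;;
     NASSIGN 0 (NConst 0) (NAdd (nvar kv) (NConst 1)) ;; RASSIGN 0 (NConst 0) (rvar eps)"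

definition store_hub :: com where
  "store_hub =
     RASSIGN hubX (nvar kv) (RArr 4 (NConst 0)) ;; RASSIGN hubY (nvar kv) (RArr 4 (NConst 1))"

definition call_weber :: "com \<Rightarrow> com" where
  "call_weber p = FOR iv (NConst 0) (nvar kv) load_point ;; load_center ;; p ;; store_hub"

definition center_hub :: com where
  "center_hub =
     RASSIGN hubX (nvar kv) (RNat (NConst 0)) ;; RASSIGN hubY (nvar kv) (RNat (NConst 0))"

abbreviation norm_exp :: "rexp \<Rightarrow> rexp \<Rightarrow> rexp" where
  "norm_exp x y \<equiv> RSqrt (RAdd (RMul x x) (RMul y y))"

definition init_cost :: com where
  "init_cost = RASSIGN group_cost (nvar kv)
     (RMul (RPow (nvar kv) (rvar alph)) (norm_exp (RArr hubX (nvar kv)) (RArr hubY (nvar kv))))"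

definition add_cost :: com where
  "add_cost = RASSIGN group_cost (nvar kv) (RAdd (RArr group_cost (nvar kv))
     (norm_exp (RSub (RArr ptX (nvar iv)) (RArr hubX (nvar kv))) (RSub (RArr ptY (nvar iv)) (RArr hubY (nvar kv)))))"

abbreviation proper_arc :: bexp where
  "proper_arc \<equiv> BAnd (NLess (NConst 1) (nvar kv)) (NLess (nvar kv) (nvar num))"

definition price_group :: "com \<Rightarrow> com" where
  "price_group p =
     COND proper_arc (call_weber p) center_hub ;; init_cost ;; FOR iv (NConst 0) (nvar kv) add_cost"

definition price_groups :: "com \<Rightarrow> com" where
  "price_groups p = FOR kv (NConst 1) (NAdd (nvar num) (NConst 1)) (price_group p)"

text \<open>A group of size one is always permitted, as capacities are at least 1, so it provides
  the first value of the entry.\<close>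

definition init_opt :: com where
  "init_opt = RASSIGN opt (nvar kv) (RAdd (RArr opt (NSub (nvar kv) (NConst 1))) (RArr group_cost (NConst 1))) ;;
     NASSIGN choice (nvar kv) (NConst 1)"

definition improve_opt :: com where
  "improve_opt =
     COND (BAnd (NLess (nvar iv) (NAdd (nvar cap) (NConst 1)))
                (RLess (RAdd (RArr opt (NSub (nvar kv) (nvar iv))) (RArr group_cost (nvar iv))) (RArr opt (nvar kv))))
       (RASSIGN opt (nvar kv) (RAdd (RArr opt (NSub (nvar kv) (nvar iv))) (RArr group_cost (nvar iv))) ;;
        NASSIGN choice (nvar kv) (nvar iv))
       SKIP"

definition partition_sizes :: com where
  "partition_sizes = RASSIGN opt (NConst 0) (RNat (NConst 0)) ;;
     FOR kv (NConst 1) (NAdd (nvar num) (NConst 1))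
       (init_opt ;; FOR iv (NConst 1) (NAdd (nvar kv) (NConst 1)) improve_opt)"

text \<open>\<open>choice\<close> is indexed by the number of sources still to be served. The stored
  hub of that size is rotated by the quotient of point i and source 0 and shifted back by the sink;
  the parent pointer 0 denotes the only sink.\<close>

definition open_group :: com where
  "open_group =
     NASSIGN kv (NConst 0) (NArr choice (NSub (nvar num) (nvar iv))) ;;
     NASSIGN next_start (NConst 0) (NAdd (nvar iv) (nvar kv)) ;;
     RASSIGN rotX (NConst 0) (RDiv (RAdd (RMul (RArr ptX (nvar iv)) (rvar srcX)) (RMul (RArr ptY (nvar iv)) (rvar srcY))) radius_sq) ;;
     RASSIGN rotY (NConst 0) (RDiv (RSub (RMul (RArr ptY (nvar iv)) (rvar srcX)) (RMul (RArr ptX (nvar iv)) (rvar srcY))) radius_sq) ;;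
     RASSIGN 5 (nvar group_count) (RAdd (rvar sinkX)
       (RSub (RMul (RArr hubX (nvar kv)) (rvar rotX)) (RMul (RArr hubY (nvar kv)) (rvar rotY)))) ;;
     RASSIGN 6 (nvar group_count) (RAdd (rvar sinkY)
       (RAdd (RMul (RArr hubX (nvar kv)) (rvar rotY)) (RMul (RArr hubY (nvar kv)) (rvar rotX)))) ;;
     NASSIGN 3 (nvar group_count) (NConst 0) ;;
     NASSIGN group_count (NConst 0) (NAdd (nvar group_count) (NConst 1))"

abbreviation req :: "rexp \<Rightarrow> rexp \<Rightarrow> bexp" where
  "req e f \<equiv> BAnd (BNot (RLess e f)) (BNot (RLess f e))"

text \<open>\<open>group_count\<close> has already been incremented, so it is one more than the
  index of the current group: with one sink, exactly the pointer to its Steiner vertex.\<close>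

definition assign_source :: com where
  "assign_source =
     COND (BAnd (req (RArr srcX (nvar jv)) (RArr ptX (nvar iv))) (req (RArr srcY (nvar jv)) (RArr ptY (nvar iv))))
       (NASSIGN 2 (nvar jv) (nvar group_count)) SKIP"

abbreviation in_group :: bexp where
  "in_group \<equiv> NLess (nvar iv) (nvar next_start)"

definition init_output :: com where
  "init_output = NASSIGN next_start (NConst 0) (NConst 0) ;; NASSIGN group_count (NConst 0) (NConst 0)"

definition write_output :: com where
  "write_output = init_output ;;
     FOR iv (NConst 0) (nvar num)
       (COND in_group SKIP open_group ;; FOR jv (NConst 0) (nvar num) assign_source) ;;
     NASSIGN 4 (NConst 0) (nvar group_count)"

definition solver :: "com \<Rightarrow> com" where
  "solver p = read_input ;; find_rotation ;; list_points ;; price_groups p ;; partition_sizes ;; write_output"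

lemmas com_defs = read_scalars_def read_source_def init_rotation_def improve_rotation_def init_point_def
  next_point_def load_point_def load_center_def store_hub_def center_hub_def init_cost_def add_cost_def
  init_opt_def improve_opt_def open_group_def assign_source_def init_output_def

definition price_time :: "nat \<Rightarrow> nat \<Rightarrow> nat" where
  "price_time n tW = bcost proper_arc + ((n + 1) * (max_cost load_point + 20) +
       (max_cost load_center + (tW + max_cost store_hub)) + max_cost center_hub) + 1 +
     (max_cost init_cost + (n + 1) * (max_cost add_cost + 20))"

definition partition_time :: "nat \<Rightarrow> nat" where
  "partition_time n = 4 + (n + 1) * (max_cost init_opt + (n + 1) * (max_cost improve_opt + 20) + 20)"

definition output_time :: "nat \<Rightarrow> nat" where
  "output_time n = max_cost init_output + ((n + 1) * (bcost in_group + (max_cost SKIP + max_cost open_group) + 1 +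
     (n + 1) * (max_cost assign_source + 20) + 20) + 4)"

definition total_time :: "nat \<Rightarrow> nat \<Rightarrow> nat" where
  "total_time n tW = max_cost read_scalars + (n + 1) * (max_cost read_source + 20) +
    (max_cost init_rotation + (n + 1) * (max_cost improve_rotation + 20) +
    (max_cost init_point + (n + 1) * (max_cost next_point + 20) +
    ((n + 1) * (price_time n tW + 20) + (partition_time n + output_time n))))"

definition time_const :: nat where
  "time_const = max_cost read_scalars + max_cost read_source + max_cost init_rotation + max_cost improve_rotation +
     max_cost init_point + max_cost next_point + bcost proper_arc + max_cost load_point + max_cost load_center +
     max_cost store_hub + max_cost center_hub + max_cost init_cost + max_cost add_cost + max_cost init_opt +
     max_cost improve_opt + max_cost init_output + bcost in_group + max_cost SKIP +
     max_cost open_group + max_cost assign_source + 300"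

text \<open>With M = n + 1 the total is bounded by a constant times the square of M plus M calls of
  the solver; M is at most 2n, which yields the factor 4.\<close>

lemma total_time_le:
  assumes "1 \<le> n"
  shows "total_time n tW \<le> (4 * time_const) * (n * tW + n\<^sup>2)"
proof -
  \<comment> \<open>The program costs are kept as variables here, so the arithmetic never unfolds
    them; the 300 absorbs all numerals.\<close>
  have *: "a1 + M * (b1 + 20) + (a2 + M * (b2 + 20) + (a3 + M * (b3 + 20) +
      (M * (d1 + (M * (d2 + 20) + (d3 + (tW + d4)) + d5) + 1 + (d6 + M * (d7 + 20)) + 20) +
      (4 + M * (e1 + M * (e2 + 20) + 20) + (f1 + (M * (f2 + (f3 + f4) + 1 + M * (f5 + 20) + 20) + 4))))))
      \<le> (a1 + b1 + a2 + b2 + a3 + b3 + d1 + d2 + d3 + d4 + d5 + d6 + d7 + e1 + e2 + f1 + f2 + f3 + f4 + f5 + 300) * M\<^sup>2 + M * tW"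
    if "1 \<le> M" for M a1 b1 a2 b2 a3 b3 d1 d2 d3 d4 d5 d6 d7 e1 e2 f1 f2 f3 f4 f5 :: nat
    using that by (cases M) (auto simp: algebra_simps power2_eq_square)
  have "total_time n tW \<le> time_const * (n + 1)\<^sup>2 + (n + 1) * tW"
    unfolding total_time_def price_time_def partition_time_def output_time_def
    by (rule order_trans[OF *]) (simp_all add: time_const_def add_ac)
  also have "\<dots> \<le> time_const * (2 * n)\<^sup>2 + (2 * n) * tW"
    using assms by (intro add_mono mult_le_mono power_mono) auto
  also have "\<dots> \<le> (4 * time_const) * (n * tW + n\<^sup>2)"
  proof -
    have "2 * (n * tW) \<le> 4 * time_const * (n * tW)" by (intro mult_le_mono1) (simp add: time_const_def)
    then show ?thesis by (simp add: power_mult_distrib algebra_simps)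
  qed
  finally show ?thesis .
qed

end

lemma norm_exp_val: "sqrt (x * x + y * y) = cmod (Complex x y)"
  by (simp add: cmod_def power2_eq_square)

section \<open>Coordinates relative to the sink and the rotation between neighbours\<close>

locale equally_spaced_run = arrays +
  fixes n c :: nat and \<epsilon> \<alpha> zx zy r \<theta> :: real and Z :: "nat \<Rightarrow> complex"
  assumes n_pos: "n \<ge> 1" and c_pos: "c \<ge> 1" and eps_pos: "\<epsilon> > 0" and r_pos: "r > 0"
    and Z_circle: "Z ` {..<n} = (\<lambda>i. rcis r (\<theta> + 2 * pi * real i / real n)) ` {..<n}"
begin

definition base_ok :: "state \<Rightarrow> bool" where
  "base_ok s \<longleftrightarrow> nats s num 0 = n \<and> nats s cap 0 = c \<and> reals s eps 0 = \<epsilon> \<and> reals s alph 0 = \<alpha> \<and>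
     reals s sinkX 0 = zx \<and> reals s sinkY 0 = zy \<and>
     (\<forall>i<n. reals s srcX i = Re (Z i) \<and> reals s srcY i = Im (Z i))"

lemma base_ok_nset [simp]: "a \<notin> {num, cap} \<Longrightarrow> base_ok (nset a i x s) = base_ok s"
  by (simp add: base_ok_def)

lemma base_ok_rset [simp]:
  "a \<notin> {eps, alph, sinkX, sinkY, srcX, srcY} \<Longrightarrow> base_ok (rset a i x s) = base_ok s"
  by (simp add: base_ok_def)

lemma base_okD:
  assumes "base_ok s"
  shows "nats s num 0 = n" "nats s cap 0 = c" "reals s eps 0 = \<epsilon>" "reals s alph 0 = \<alpha>"
    "reals s sinkX 0 = zx" "reals s sinkY 0 = zy" "i < n \<Longrightarrow> reals s srcX i = Re (Z i)" "i < n \<Longrightarrow> reals s srcY i = Im (Z i)"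
    "reals s srcX 0 = Re (Z 0)" "reals s srcY 0 = Im (Z 0)"
  using assms n_pos by (auto simp: base_ok_def)

lemma norm_Z: "i < n \<Longrightarrow> cmod (Z i) = r"
proof -
  assume "i < n"
  then have "Z i \<in> Z ` {..<n}" by simp
  then show ?thesis unfolding Z_circle using r_pos by auto
qed

lemma Z0_nonzero: "Z 0 \<noteq> 0"
  using norm_Z[of 0] n_pos r_pos by auto

lemma radius_sq_val: "Re (Z 0) * Re (Z 0) + Im (Z 0) * Im (Z 0) = r\<^sup>2"
  using norm_Z[of 0] n_pos by (simp add: cmod_power2[symmetric] flip: power2_eq_square)

lemma runs_read_input:
  assumes "nats s 0 0 = n" "nats s 1 1 = c" "reals s 0 0 = \<epsilon>" "reals s 0 1 = \<alpha>" "reals s 3 0 = zx" "reals s 4 0 = zy"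
    and "\<And>i. i < n \<Longrightarrow> reals s 1 i = zx + Re (Z i) \<and> reals s 2 i = zy + Im (Z i)"
  shows "runs read_input s (max_cost read_scalars + (n + 1) * (max_cost read_source + 20)) base_ok"
proof -
  define Inv :: "nat \<Rightarrow> state \<Rightarrow> bool" where "Inv m s \<longleftrightarrow> nats s num 0 = n \<and> nats s cap 0 = c \<and> reals s eps 0 = \<epsilon> \<and> reals s alph 0 = \<alpha> \<and>
     reals s sinkX 0 = zx \<and> reals s sinkY 0 = zy \<and>
     (\<forall>i<m. reals s srcX i = Re (Z i) \<and> reals s srcY i = Im (Z i)) \<and>
     (\<forall>i<n. reals s 1 i = zx + Re (Z i) \<and> reals s 2 i = zy + Im (Z i))" for m s
  have "runs read_scalars s (max_cost read_scalars) (Inv 0)"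
    by (rule runs_loop_free) (use assms in \<open>simp_all add: com_defs Inv_def\<close>)
  then have "runs read_input s (max_cost read_scalars + (n - 0 + 1) * (max_cost read_source + 20)) (Inv n)"
    unfolding read_input_def
  proof (rule runs_SEQ, intro runs_FOR)
    fix k s assume "k < n" "Inv k s" "nats s iv 0 = k"
    then show "runs read_source s (max_cost read_source) (\<lambda>s'. Inv (Suc k) s' \<and> nats s' iv 0 = k)"
      by (intro runs_loop_free) (auto simp: com_defs Inv_def less_Suc_eq)
  qed (auto simp: Inv_def)
  then show ?thesis by (rule runs_mono) (auto simp: Inv_def base_ok_def)
qed

definition rot_ok :: "real \<Rightarrow> state \<Rightarrow> bool" where
  "rot_ok \<sigma> s \<longleftrightarrow> (\<sigma> = 1 \<or> \<sigma> = -1) \<and> reals s rotX 0 = Re (turn \<sigma> n 1) \<and> reals s rotY 0 = Im (turn \<sigma> n 1)"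

lemma runs_find_rotation:
  assumes "base_ok s"
  shows "runs find_rotation s (max_cost init_rotation + (n + 1) * (max_cost improve_rotation + 20))
    (\<lambda>s. base_ok s \<and> (\<exists>\<sigma>. rot_ok \<sigma> s))"
proof -
  define ip where "ip j = Re (Z j * cnj (Z 0))" for j
  have ip_lower: "- 2 * r\<^sup>2 < ip j" if "j < n" for j
  proof -
    have "\<bar>ip j\<bar> \<le> cmod (Z j * cnj (Z 0))" unfolding ip_def by (rule abs_Re_le_cmod)
    also have "\<dots> = r\<^sup>2" using that norm_Z n_pos by (simp add: norm_mult power2_eq_square)
    finally show ?thesis using r_pos by (smt (verit) zero_less_power)
  qed
  \<comment> \<open>The first alternative is the state before any candidate was seen. By
    \<open>ip_lower\<close> the first candidate always moves on to the second one, which names the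
    best source so far.\<close>
  define Inv :: "nat \<Rightarrow> state \<Rightarrow> bool" where "Inv m s \<longleftrightarrow> base_ok s \<and>
      (m = 1 \<and> reals s rotX 0 = 1 \<and> reals s rotY 0 = 0 \<and> reals s best 0 = - 2 * r\<^sup>2 \<or>
       (\<exists>j. 1 \<le> j \<and> j < m \<and> reals s best 0 = ip j \<and> reals s rotX 0 = Re (Z j / Z 0) \<and>
          reals s rotY 0 = Im (Z j / Z 0) \<and> (\<forall>i. 1 \<le> i \<and> i < m \<longrightarrow> ip i \<le> ip j)))" for m s
  have "runs init_rotation s (max_cost init_rotation) (Inv 1)"
    by (rule runs_loop_free) (use assms radius_sq_val in \<open>simp_all add: com_defs base_okD Inv_def\<close>)
  then have "runs find_rotation s (max_cost init_rotation + (n - 1 + 1) * (max_cost improve_rotation + 20)) (Inv n)"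
    unfolding find_rotation_def
  proof (rule runs_SEQ, intro runs_FOR)
    fix k s assume k: "1 \<le> k" "k < n" "Inv k s" "nats s jv 0 = k"
    then have base: "base_ok s" by (simp add: Inv_def)
    have inner: "rval inner_src s = ip k" using k base by (simp add: base_okD ip_def algebra_simps)
    have quot: "Re (Z k / Z 0) = ip k / r\<^sup>2" "Im (Z k / Z 0) = (Re (Z 0) * Im (Z k) - Im (Z 0) * Re (Z k)) / r\<^sup>2"
      using radius_sq_val by (simp_all add: Re_divide Im_divide power2_eq_square ip_def algebra_simps)
    show "runs improve_rotation s (max_cost improve_rotation) (\<lambda>s'. Inv (Suc k) s' \<and> nats s' jv 0 = k)"
    proof (rule runs_loop_free)
      show "Inv (Suc k) (result improve_rotation s) \<and> nats (result improve_rotation s) jv 0 = k"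
      proof (cases "reals s best 0 < ip k")
        case True
        then have "bval (RLess (rvar best) inner_src) s" using inner by simp
        then have res: "result improve_rotation s = rset rotY 0 (Im (Z k / Z 0)) (rset rotX 0 (Re (Z k / Z 0)) (rset best 0 (ip k) s))"
          unfolding improve_rotation_def using k base radius_sq_val by (simp add: base_okD quot ip_def algebra_simps)
        have "\<forall>i. 1 \<le> i \<and> i < Suc k \<longrightarrow> ip i \<le> ip k"
          using k(3) True unfolding Inv_def by (auto simp: less_Suc_eq)
        then show ?thesis unfolding res Inv_def using base k by auto
      next
        case False
        then have "result improve_rotation s = s" unfolding improve_rotation_def using inner by simp
        then show ?thesis using k False ip_lower[of k] unfolding Inv_def by (auto simp: less_Suc_eq)
      qed
    qed (simp add: com_defs)
  qed (use n_pos in \<open>auto simp: Inv_def base_okD\<close>)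
  then show ?thesis
  proof (rule runs_mono)
    fix s assume I: "Inv n s"
    show "base_ok s \<and> (\<exists>\<sigma>. rot_ok \<sigma> s)"
    proof (cases "n = 1")
      case True
      then have "turn 1 n 1 = 1" by (simp add: turn_def)
      then have "rot_ok 1 s" using I True unfolding rot_ok_def Inv_def by auto
      then show ?thesis using I by (auto simp: Inv_def)
    next
      case False
      then obtain j where j: "1 \<le> j" "j < n" "reals s rotX 0 = Re (Z j / Z 0)" "reals s rotY 0 = Im (Z j / Z 0)"
        "\<And>i. 1 \<le> i \<Longrightarrow> i < n \<Longrightarrow> ip i \<le> ip j"
        using I by (auto simp: Inv_def)
      have "Z j / Z 0 = turn 1 n 1 \<or> Z j / Z 0 = turn (-1) n 1"
        using False n_pos r_pos Z_circle j unfolding ip_def by (intro max_inner_product_imp_neighbour[where r = r]) auto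
      then have "rot_ok 1 s \<or> rot_ok (-1) s" using j unfolding rot_ok_def by auto
      then show ?thesis using I by (auto simp: Inv_def)
    qed
  qed (use n_pos in auto)
qed

end

text \<open>\<open>\<sigma>\<close> records whether the search for a neighbour of source 0 went counterclockwise or clockwise.\<close>

locale oriented_run = equally_spaced_run +
  fixes \<sigma> :: real
  assumes \<sigma>: "\<sigma> = 1 \<or> \<sigma> = -1"
begin

definition pt :: "nat \<Rightarrow> complex" where
  "pt i = Z 0 * turn \<sigma> n (int i)"

definition pts_ok :: "nat \<Rightarrow> state \<Rightarrow> bool" where
  "pts_ok m s \<longleftrightarrow> (\<forall>i\<le>m. reals s ptX i = Re (pt i) \<and> reals s ptY i = Im (pt i))"

lemma pt_Suc: "pt (Suc i) = turn \<sigma> n 1 * pt i"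
  using turn_add[of \<sigma> n 1 "int i"] by (simp add: pt_def)

lemma runs_list_points:
  assumes "base_ok s" "rot_ok \<sigma> s"
  shows "runs list_points s (max_cost init_point + (n + 1) * (max_cost next_point + 20))
    (\<lambda>s. base_ok s \<and> pts_ok n s)"
proof -
  define Inv :: "nat \<Rightarrow> state \<Rightarrow> bool" where "Inv m s \<longleftrightarrow> base_ok s \<and> rot_ok \<sigma> s \<and> pts_ok m s" for m s
  have "runs init_point s (max_cost init_point) (Inv 0)"
    by (rule runs_loop_free) (use assms in \<open>auto simp: com_defs base_okD Inv_def rot_ok_def pts_ok_def pt_def\<close>)
  then have "runs list_points s (max_cost init_point + (n - 0 + 1) * (max_cost next_point + 20)) (Inv n)"
    unfolding list_points_def
  proof (rule runs_SEQ, intro runs_FOR)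
    fix k s assume k: "k < n" "Inv k s" "nats s iv 0 = k"
    then have "reals s ptX k = Re (pt k)" "reals s ptY k = Im (pt k)" by (simp_all add: Inv_def pts_ok_def)
    then show "runs next_point s (max_cost next_point) (\<lambda>s'. Inv (Suc k) s' \<and> nats s' iv 0 = k)"
      using k by (intro runs_loop_free) (auto simp: com_defs Inv_def rot_ok_def pts_ok_def le_Suc_eq pt_Suc)
  qed (auto simp: Inv_def rot_ok_def pts_ok_def base_okD)
  then show ?thesis by (rule runs_mono) (auto simp: Inv_def)
qed

end

section \<open>Group prices and the choice of group sizes\<close>

lemma dist_eq_cmod: "dist p q = cmod (Complex (fst p) (snd p) - Complex (fst q) (snd q))"
  by (simp add: dist_prod_def dist_real_def cmod_def complex_diff)

text \<open>All sizes below \<open>u\<close> have been tried for entry k. Hence the same notion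
  describes the entry during the inner loop and, with \<open>u = Suc k\<close>, when it is
  finished.\<close>

definition dp_entry :: "nat \<Rightarrow> (nat \<Rightarrow> real) \<Rightarrow> (nat \<Rightarrow> real) \<Rightarrow> (nat \<Rightarrow> nat) \<Rightarrow> nat \<Rightarrow> nat \<Rightarrow> bool" where
  "dp_entry c g D C k u \<longleftrightarrow> 1 \<le> C k \<and> C k \<le> k \<and> C k \<le> c \<and> D k = D (k - C k) + g (C k) \<and>
     (\<forall>i. 1 \<le> i \<and> i < u \<and> i \<le> c \<longrightarrow> D k \<le> D (k - i) + g i)"

definition dp_table :: "nat \<Rightarrow> (nat \<Rightarrow> real) \<Rightarrow> (nat \<Rightarrow> real) \<Rightarrow> (nat \<Rightarrow> nat) \<Rightarrow> nat \<Rightarrow> bool" where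
  "dp_table c g D C m \<longleftrightarrow> D 0 = 0 \<and> (\<forall>k. 1 \<le> k \<and> k < m \<longrightarrow> dp_entry c g D C k (Suc k))"

lemma dp_tableD: "dp_table c g D C m \<Longrightarrow> 1 \<le> k \<Longrightarrow> k < m \<Longrightarrow> dp_entry c g D C k (Suc k)"
  by (simp add: dp_table_def)

lemma dp_entry_cong:
  assumes "\<And>i. i \<le> k \<Longrightarrow> D i = D' i" "C k = C' k"
  shows "dp_entry c g D C k u = dp_entry c g D' C' k u"
  unfolding dp_entry_def using assms by simp

lemma dp_table_cong:
  assumes "\<And>i. i < m \<Longrightarrow> D i = D' i \<and> C i = C' i" "1 \<le> m"
  shows "dp_table c g D C m = dp_table c g D' C' m"
proof -
  have "dp_entry c g D C k (Suc k) = dp_entry c g D' C' k (Suc k)" if "k < m" for k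
    using that assms(1) by (intro dp_entry_cong) auto
  then show ?thesis using assms by (auto simp: dp_table_def)
qed

text \<open>Removing one group at a time lowers the argument of \<open>D\<close> by its size, and
  the minimality of each entry pays for the price of the removed group.\<close>

lemma dp_table_lower_bound:
  assumes "dp_table c g D C (Suc n)" "finite A" "\<And>v. v \<in> A \<Longrightarrow> 1 \<le> f v \<and> f v \<le> c" "sum f A \<le> n"
  shows "D (sum f A) \<le> (\<Sum>v\<in>A. g (f v))"
  using assms(2-4)
proof (induction A rule: finite_induct)
  case empty
  then show ?case using assms(1) by (simp add: dp_table_def)
next
  case (insert v A)
  have fv: "1 \<le> f v" "f v \<le> c" using insert by auto
  have k: "sum f (insert v A) = f v + sum f A" using insert by simp
  have "dp_entry c g D C (f v + sum f A) (Suc (f v + sum f A))"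
    using assms(1) fv insert.prems(2) k unfolding dp_table_def by auto
  then have "D (f v + sum f A) \<le> D (f v + sum f A - f v) + g (f v)"
    using fv unfolding dp_entry_def by (meson le_add1 le_imp_less_Suc)
  moreover have "D (sum f A) \<le> (\<Sum>v\<in>A. g (f v))" using insert k by simp
  ultimately show ?case using insert k by simp
qed

text \<open>First position of group \<open>a\<close> when the table is unrolled from \<open>n\<close>: the group that starts at position
  \<open>i\<close> has size \<open>C (n - i)\<close>.\<close>

primrec start :: "(nat \<Rightarrow> nat) \<Rightarrow> nat \<Rightarrow> nat \<Rightarrow> nat" where
  "start C n 0 = 0"
| "start C n (Suc a) = start C n a + C (n - start C n a)"

lemma start_mono: "x \<le> y \<Longrightarrow> start C n x \<le> start C n y"
  by (rule lift_Suc_mono_le[of "start C n"]) auto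

text \<open>The recurrences along the chosen sizes telescope. Once the starts reach n, the remaining
  term is \<open>D 0\<close>, which is 0.\<close>

lemma dp_table_unroll:
  assumes dp: "dp_table c g D C (Suc n)" and lt: "\<forall>x<a. start C n x < n"
  shows "start C n a \<le> n \<and> D n = (\<Sum>x<a. g (C (n - start C n x))) + D (n - start C n a)"
  using lt
proof (induction a)
  case (Suc a)
  then have IH: "D n = (\<Sum>x<a. g (C (n - start C n x))) + D (n - start C n a)" and a: "start C n a < n" by auto
  let ?k = "n - start C n a"
  have "dp_entry c g D C ?k (Suc ?k)" using a by (intro dp_tableD[OF dp]) auto
  then have "C ?k \<le> ?k" "D ?k = D (?k - C ?k) + g (C ?k)" by (auto simp: dp_entry_def)
  moreover from this have "start C n a + C ?k \<le> n" using a by linarith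
  ultimately show ?case using IH a by simp
qed simp

section \<open>Pricing one arc of each size\<close>

context oriented_run
begin

lemma pts_ok_nset [simp]: "pts_ok m (nset a i x s) = pts_ok m s"
  by (simp add: pts_ok_def)

lemma pts_ok_rset [simp]: "a \<notin> {ptX, ptY} \<Longrightarrow> pts_ok m (rset a i x s) = pts_ok m s"
  by (simp add: pts_ok_def)

lemma pts_okD:
  assumes "pts_ok n s" "i \<le> n"
  shows "reals s ptX i = Re (pt i)" "reals s ptY i = Im (pt i)"
  using assms by (auto simp: pts_ok_def)

lemma inj_pt: "i < n \<Longrightarrow> j < n \<Longrightarrow> pt i = pt j \<Longrightarrow> i = j"
  using turn_inj_on_window[OF n_pos \<sigma> order_refl, of 0] Z0_nonzero
  by (auto simp: pt_def dest: inj_onD[of _ _ "int i" "int j"])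

lemma pt_nonzero: "pt i \<noteq> 0"
  using Z0_nonzero norm_turn[of \<sigma> n "int i"] by (auto simp: pt_def simp del: norm_turn)

abbreviation arc :: "nat \<Rightarrow> complex \<Rightarrow> real" where
  "arc \<equiv> arc_cost (Z 0) \<sigma> n \<alpha>"

definition hub :: "state \<Rightarrow> nat \<Rightarrow> complex" where
  "hub s k = Complex (reals s hubX k) (reals s hubY k)"

lemma hub_nset [simp]: "hub (nset a i x s) = hub s"
  by (simp add: hub_def fun_eq_iff)

lemma hub_rset [simp]: "a \<notin> {hubX, hubY} \<Longrightarrow> hub (rset a i x s) = hub s"
  by (simp add: hub_def fun_eq_iff)

definition near_opt :: "nat \<Rightarrow> complex \<Rightarrow> bool" where
  "near_opt k w \<longleftrightarrow> (\<forall>y. arc k w \<le> (1 + \<epsilon>) * arc k y)"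

definition priced :: "nat \<Rightarrow> state \<Rightarrow> bool" where
  "priced m s \<longleftrightarrow> (\<forall>k. 1 \<le> k \<and> k < m \<longrightarrow> near_opt k (hub s k) \<and> reals s group_cost k = arc k (hub s k))"

lemma priced_nset [simp]: "priced m (nset a i x s) = priced m s"
  by (simp add: priced_def)

lemma priced_rset [simp]: "a \<notin> {hubX, hubY, group_cost} \<Longrightarrow> priced m (rset a i x s) = priced m s"
  by (simp add: priced_def)

lemma priced_rset_ge [simp]: "m \<le> i \<Longrightarrow> priced m (rset a i x s) = priced m s"
  by (auto simp: priced_def hub_def)

lemma near_opt_center: "1 \<le> k \<Longrightarrow> k = 1 \<or> k = n \<Longrightarrow> near_opt k 0"
  unfolding near_opt_def
proof
  fix y assume k: "1 \<le> k" "k = 1 \<or> k = n"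
  have "arc k 0 \<le> arc k y" using arc_cost_center_le[OF n_pos \<sigma> k(2)] by simp
  also have "\<dots> \<le> (1 + \<epsilon>) * arc k y" using eps_pos arc_cost_nonneg[of "Z 0" \<sigma> n \<alpha> k y] by (simp add: algebra_simps)
  finally show "arc k 0 \<le> (1 + \<epsilon>) * arc k y" .
qed

definition weber_points :: "nat \<Rightarrow> (point \<times> real) list" where
  "weber_points k = map (\<lambda>i. ((Re (pt i), Im (pt i)), 1)) [0..<k] @ [((0, 0), real k powr \<alpha>)]"

lemma length_weber_points [simp]: "length (weber_points k) = Suc k"
  by (simp add: weber_points_def)

lemma weighted_dist_weber_points: "weighted_dist (weber_points k) x = arc k (Complex (fst x) (snd x))"
proof -
  let ?x = "Complex (fst x) (snd x)"
  have "weighted_dist (weber_points k) x = (\<Sum>i\<leftarrow>[0..<k]. dist x (Re (pt i), Im (pt i))) + real k powr \<alpha> * dist x (0, 0)"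
    by (simp add: weighted_dist_def weber_points_def o_def)
  also have "(\<Sum>i\<leftarrow>[0..<k]. dist x (Re (pt i), Im (pt i))) = (\<Sum>i<k. cmod (pt i - ?x))"
    by (simp add: dist_eq_cmod norm_minus_commute sum_list_distinct_conv_sum_set atLeast_upt)
  also have "dist x (0, 0) = cmod ?x" by (simp add: dist_eq_cmod flip: zero_complex.code)
  finally show ?thesis by (simp add: arc_cost_def pt_def)
qed

lemma weighted_point_set_weber_points:
  assumes "1 \<le> k" "k < n"
  shows "weighted_point_set (weber_points k)"
proof -
  have "inj_on (\<lambda>i. (Re (pt i), Im (pt i))) {..<k}"
    using inj_pt assms by (auto simp: inj_on_def complex_eq_iff)
  moreover have "(0, 0) \<noteq> (Re (pt i), Im (pt i))" for i
    using pt_nonzero[of i] by (auto simp: complex_eq_iff)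
  ultimately have "distinct (map fst (weber_points k))"
    by (auto simp: weber_points_def distinct_map o_def atLeast_upt[symmetric] lessThan_atLeast0)
  then show ?thesis using assms by (auto simp: weighted_point_set_def weber_points_def)
qed

lemma runs_call_weber:
  assumes p: "weber_solver p T" "write_bound p \<le> b"
    and s: "base_ok s" "pts_ok n s" "priced k s" "nats s kv 0 = k" and k: "1 < k" "k < n"
  shows "runs (call_weber p) s
    ((n + 1) * (max_cost load_point + 20) + (max_cost load_center + (nat \<lfloor>T n \<epsilon>\<rfloor> + max_cost store_hub)))
    (\<lambda>s. base_ok s \<and> pts_ok n s \<and> priced k s \<and> nats s kv 0 = k \<and> near_opt k (hub s k))"
proof -
  define J where "J s \<longleftrightarrow> base_ok s \<and> pts_ok n s \<and> priced k s \<and> nats s kv 0 = k" for s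
  define Inv where "Inv m s \<longleftrightarrow> J s \<and>
      (\<forall>i<m. reals s 1 i = Re (pt i) \<and> reals s 2 i = Im (pt i) \<and> reals s 3 i = 1)" for m s
  have "runs (FOR iv (NConst 0) (nvar kv) load_point) s ((k - 0 + 1) * (max_cost load_point + 20)) (Inv k)"
  proof (rule runs_FOR)
    fix m s assume "m < k" "Inv m s" "nats s iv 0 = m"
    then show "runs load_point s (max_cost load_point) (\<lambda>s'. Inv (Suc m) s' \<and> nats s' iv 0 = m)"
      using k by (intro runs_loop_free) (auto simp: com_defs Inv_def J_def pts_okD less_Suc_eq)
  qed (use s in \<open>auto simp: Inv_def J_def\<close>)
  then have 1: "runs (FOR iv (NConst 0) (nvar kv) load_point) s ((n + 1) * (max_cost load_point + 20)) (Inv k)"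
    by (rule runs_mono) (use k in auto)
  have 2: "runs load_center s (max_cost load_center) (\<lambda>s. J s \<and> weber_input \<epsilon> (weber_points k) s)" if "Inv k s" for s
  proof (rule runs_loop_free)
    show "J (result load_center s) \<and> weber_input \<epsilon> (weber_points k) (result load_center s)"
      using that by (auto simp: com_defs Inv_def J_def base_okD weber_input_def weber_points_def nth_append less_Suc_eq)
  qed (simp add: com_defs)
  have 3: "runs p s (nat \<lfloor>T n \<epsilon>\<rfloor>) (\<lambda>s. J s \<and> approx_weber_point \<epsilon> (weber_points k) (weber_output s))"
    if "J s" "weber_input \<epsilon> (weber_points k) s" for s
  proof -
    \<comment> \<open>The problem has k + 1 points, and k < n brings it within the time bound for n
      points.\<close>
    obtain t s' where t: "exec p s t s'" "real t \<le> T n \<epsilon>" "approx_weber_point \<epsilon> (weber_points k) (weber_output s')"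
      using p(1) \<open>weber_input \<epsilon> (weber_points k) s\<close> eps_pos weighted_point_set_weber_points[of k] k unfolding weber_solver_def
      by (metis Suc_leI length_weber_points less_imp_le)
    \<comment> \<open>The solver may leave anything in arrays below \<open>b\<close>; the tables all
      lie above and are unchanged.\<close>
    have "nats s' a = nats s a" "reals s' a = reals s a" if "b \<le> a" for a
      using exec_frame[OF t(1), of a] p(2) that by auto
    then have "J s'" using \<open>J s\<close> by (simp add: J_def base_ok_def pts_ok_def priced_def hub_def)
    moreover have "t \<le> nat \<lfloor>T n \<epsilon>\<rfloor>" using t(2) by linarith
    ultimately show ?thesis using t unfolding runs_def by blast
  qed
  have 4: "runs store_hub s (max_cost store_hub)
      (\<lambda>s. base_ok s \<and> pts_ok n s \<and> priced k s \<and> nats s kv 0 = k \<and> near_opt k (hub s k))"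
    if "J s" "approx_weber_point \<epsilon> (weber_points k) (weber_output s)" for s
  proof (rule runs_loop_free)
    have "arc k (Complex (reals s 4 0) (reals s 4 1)) \<le> (1 + \<epsilon>) * arc k y" for y
      using that(2) unfolding approx_weber_point_def weighted_dist_weber_points weber_output_def
      by (metis complex.collapse fst_conv snd_conv)
    then show "base_ok (result store_hub s) \<and> pts_ok n (result store_hub s) \<and> priced k (result store_hub s) \<and>
        nats (result store_hub s) kv 0 = k \<and> near_opt k (hub (result store_hub s) k)"
      using that(1) by (auto simp: com_defs J_def near_opt_def hub_def)
  qed (simp add: com_defs)
  show ?thesis
    unfolding call_weber_def using 1 2 3 4
    by (intro runs_SEQ[of _ _ _ "Inv k"] runs_SEQ[of _ _ _ "\<lambda>s. J s \<and> weber_input \<epsilon> (weber_points k) s"]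
        runs_SEQ[of _ _ _ "\<lambda>s. J s \<and> approx_weber_point \<epsilon> (weber_points k) (weber_output s)"]) auto
qed

lemma runs_price_group:
  assumes p: "weber_solver p T" "write_bound p \<le> b"
    and s: "base_ok s" "pts_ok n s" "priced k s" "nats s kv 0 = k" and k: "1 \<le> k" "k \<le> n"
  shows "runs (price_group p) s (price_time n (nat \<lfloor>T n \<epsilon>\<rfloor>))
    (\<lambda>s. base_ok s \<and> pts_ok n s \<and> priced (Suc k) s \<and> nats s kv 0 = k)"
proof -
  define J where "J s \<longleftrightarrow> base_ok s \<and> pts_ok n s \<and> priced k s \<and> nats s kv 0 = k \<and> near_opt k (hub s k)" for s
  have 1: "runs (COND proper_arc (call_weber p) center_hub) s (bcost proper_arc +
      ((n + 1) * (max_cost load_point + 20) + (max_cost load_center + (nat \<lfloor>T n \<epsilon>\<rfloor> + max_cost store_hub)) + max_cost center_hub) + 1) J"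
  proof (rule runs_COND)
    assume "bval proper_arc s"
    then have "1 < k" "k < n" using s by (auto simp: base_okD)
    from runs_call_weber[OF p s this] show "runs (call_weber p) s ((n + 1) * (max_cost load_point + 20) +
        (max_cost load_center + (nat \<lfloor>T n \<epsilon>\<rfloor> + max_cost store_hub)) + max_cost center_hub) J"
      by (rule runs_mono) (auto simp: J_def)
  next
    assume "\<not> bval proper_arc s"
    then have "k = 1 \<or> k = n" using s k by (auto simp: base_okD)
    then have "near_opt k (Complex 0 0)" using near_opt_center k by (simp flip: zero_complex.code)
    then have "runs center_hub s (max_cost center_hub) J"
      using s by (intro runs_loop_free) (auto simp: com_defs J_def hub_def)
    then show "runs center_hub s ((n + 1) * (max_cost load_point + 20) +
        (max_cost load_center + (nat \<lfloor>T n \<epsilon>\<rfloor> + max_cost store_hub)) + max_cost center_hub) J"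
      by (rule runs_mono) auto
  qed
  define Inv where "Inv m s \<longleftrightarrow> J s \<and>
      reals s group_cost k = real k powr \<alpha> * cmod (hub s k) + (\<Sum>i<m. cmod (pt i - hub s k))" for m s
  have 2: "runs init_cost s (max_cost init_cost) (Inv 0)" if "J s" for s
    using that by (intro runs_loop_free) (auto simp: com_defs Inv_def J_def base_okD hub_def norm_exp_val)
  have 3: "runs (FOR iv (NConst 0) (nvar kv) add_cost) s ((n + 1) * (max_cost add_cost + 20)) (Inv k)" if "Inv 0 s" for s
  proof -
    have "runs (FOR iv (NConst 0) (nvar kv) add_cost) s ((k - 0 + 1) * (max_cost add_cost + 20)) (Inv k)"
    proof (rule runs_FOR)
      fix m s assume m: "m < k" "Inv m s" "nats s iv 0 = m"
      have "cmod (pt m - hub s k) = cmod (Complex (Re (pt m) - reals s hubX k) (Im (pt m) - reals s hubY k))"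
        by (simp add: cmod_def hub_def)
      then show "runs add_cost s (max_cost add_cost) (\<lambda>s'. Inv (Suc m) s' \<and> nats s' iv 0 = m)"
        using m k by (intro runs_loop_free) (auto simp: com_defs Inv_def J_def pts_okD norm_exp_val)
    qed (use that in \<open>auto simp: Inv_def J_def\<close>)
    then show ?thesis by (rule runs_mono) (use k in auto)
  qed
  have "runs (price_group p) s (price_time n (nat \<lfloor>T n \<epsilon>\<rfloor>)) (Inv k)"
    unfolding price_group_def price_time_def by (intro runs_SEQ[OF 1] runs_SEQ[OF 2] 3)
  then show ?thesis
    by (rule runs_mono) (auto simp: Inv_def J_def priced_def less_Suc_eq arc_cost_def pt_def add.commute)
qed

lemma runs_price_groups:
  assumes p: "weber_solver p T" "write_bound p \<le> b" and s: "base_ok s" "pts_ok n s"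
  shows "runs (price_groups p) s ((n + 1) * (price_time n (nat \<lfloor>T n \<epsilon>\<rfloor>) + 20))
    (\<lambda>s. base_ok s \<and> pts_ok n s \<and> priced (Suc n) s)"
proof -
  define Inv where "Inv m s \<longleftrightarrow> base_ok s \<and> pts_ok n s \<and> priced m s" for m s
  have "runs (price_groups p) s ((Suc n - 1 + 1) * (price_time n (nat \<lfloor>T n \<epsilon>\<rfloor>) + 20)) (Inv (Suc n))"
    unfolding price_groups_def
  proof (rule runs_FOR)
    fix k s assume "1 \<le> k" "k < Suc n" "Inv k s" "nats s kv 0 = k"
    then show "runs (price_group p) s (price_time n (nat \<lfloor>T n \<epsilon>\<rfloor>)) (\<lambda>s'. Inv (Suc k) s' \<and> nats s' kv 0 = k)"
      using runs_price_group[OF p, of s k] by (auto simp: Inv_def elim: runs_mono)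
  qed (use s in \<open>auto simp: Inv_def base_okD priced_def\<close>)
  then show ?thesis by (rule runs_mono) (auto simp: Inv_def)
qed

end

section \<open>Computing the partition table\<close>

context oriented_run
begin

abbreviation table_ok :: "nat \<Rightarrow> state \<Rightarrow> bool" where
  "table_ok m s \<equiv> dp_table c (reals s group_cost) (reals s opt) (nats s choice) m"

lemma runs_partition_sizes:
  assumes "base_ok s" "pts_ok n s" "priced (Suc n) s"
  shows "runs partition_sizes s (partition_time n)
    (\<lambda>s. base_ok s \<and> pts_ok n s \<and> priced (Suc n) s \<and> table_ok (Suc n) s)"
proof -
  define J where "J s \<longleftrightarrow> base_ok s \<and> pts_ok n s \<and> priced (Suc n) s" for s
  have J_nset: "J (nset a i x s) = J s" if "a \<notin> {num, cap}" for a i x s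
    using that by (simp add: J_def)
  have J_rset: "J (rset opt i x s) = J s" for i x s by (simp add: J_def)
  have cap: "nats s cap 0 = c" "nats s num 0 = n" if "J s" for s using that by (simp_all add: J_def base_okD)
  define Inv where "Inv m s \<longleftrightarrow> J s \<and> table_ok m s" for m s
  have 1: "runs (RASSIGN opt (NConst 0) (RNat (NConst 0))) s 4 (Inv 1)"
    unfolding runs_def
    using exec_RASSIGN[of opt "NConst 0" "RNat (NConst 0)" s] assms
    by (intro exI conjI) (auto simp: Inv_def J_def dp_table_def)
  have body: "runs (init_opt ;; FOR iv (NConst 1) (NAdd (nvar kv) (NConst 1)) improve_opt) s
      (max_cost init_opt + (n + 1) * (max_cost improve_opt + 20)) (\<lambda>s'. Inv (Suc k) s' \<and> nats s' kv 0 = k)"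
    if k: "1 \<le> k" "k < Suc n" "Inv k s" "nats s kv 0 = k" for k s
  proof -
    define Inv' where "Inv' m s \<longleftrightarrow> J s \<and> table_ok k s \<and> nats s kv 0 = k \<and>
        dp_entry c (reals s group_cost) (reals s opt) (nats s choice) k m" for m s
    have a: "runs init_opt s (max_cost init_opt) (Inv' 1)"
    proof (rule runs_loop_free)
      let ?s = "result init_opt s"
      have "table_ok k ?s = table_ok k s"
        unfolding init_opt_def using k by (simp, intro dp_table_cong) auto
      moreover have "J ?s = J s" using k by (simp add: init_opt_def J_nset J_rset)
      moreover have "dp_entry c (reals ?s group_cost) (reals ?s opt) (nats ?s choice) k 1"
        using k c_pos by (auto simp: dp_entry_def init_opt_def)
      ultimately show "Inv' 1 ?s" using k by (auto simp: Inv_def Inv'_def init_opt_def)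
    qed (simp add: com_defs)
    have b: "runs (FOR iv (NConst 1) (NAdd (nvar kv) (NConst 1)) improve_opt) s ((n + 1) * (max_cost improve_opt + 20)) (Inv' (Suc k))"
      if "Inv' 1 s" for s
    proof -
      have "runs (FOR iv (NConst 1) (NAdd (nvar kv) (NConst 1)) improve_opt) s ((Suc k - 1 + 1) * (max_cost improve_opt + 20)) (Inv' (Suc k))"
      proof (rule runs_FOR)
        fix m s assume m: "1 \<le> m" "m < Suc k" "Inv' m s" "nats s iv 0 = m"
        let ?cand = "reals s opt (k - m) + reals s group_cost m"
        have J: "J s" and t: "table_ok k s" and kk: "nats s kv 0 = k"
          and e: "dp_entry c (reals s group_cost) (reals s opt) (nats s choice) k m"
          using m by (auto simp: Inv'_def)
        show "runs improve_opt s (max_cost improve_opt) (\<lambda>s'. Inv' (Suc m) s' \<and> nats s' iv 0 = m)"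
        proof (rule runs_loop_free)
          show "Inv' (Suc m) (result improve_opt s) \<and> nats (result improve_opt s) iv 0 = m"
          proof (cases "m \<le> c \<and> ?cand < reals s opt k")
            case True
            then have res: "result improve_opt s = nset choice k m (rset opt k ?cand s)"
              unfolding improve_opt_def using m kk cap[OF J] by simp
            \<comment> \<open>The finished part of the table concerns only entries below k, so
              overwriting entry k does not affect it.\<close>
            have "table_ok k (nset choice k m (rset opt k ?cand s)) = table_ok k s"
              using k by (simp, intro dp_table_cong) auto
            moreover have "dp_entry c (reals s group_cost) ((reals s opt)(k := ?cand)) ((nats s choice)(k := m)) k (Suc m)"
              unfolding dp_entry_def
            proof (intro conjI allI impI)
              fix i assume i: "1 \<le> i \<and> i < Suc m \<and> i \<le> c"
              have "?cand \<le> reals s opt (k - i) + reals s group_cost i"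
              proof (cases "i = m")
                case False
                then have "i < m" using i by simp
                then have "reals s opt k \<le> reals s opt (k - i) + reals s group_cost i"
                  using e i unfolding dp_entry_def by blast
                then show ?thesis using True by linarith
              qed simp
              then show "((reals s opt)(k := ?cand)) k \<le> ((reals s opt)(k := ?cand)) (k - i) + reals s group_cost i"
                using k i by auto
            qed (use m True k in auto)
            ultimately show ?thesis unfolding res using m k t J kk by (simp add: Inv'_def J_nset J_rset)
          next
            case False
            then have res: "result improve_opt s = s"
              unfolding improve_opt_def using m kk cap[OF J] by auto
            have "dp_entry c (reals s group_cost) (reals s opt) (nats s choice) k (Suc m)"
              using e False unfolding dp_entry_def by (auto simp: less_Suc_eq)
            then show ?thesis unfolding res using m by (simp add: Inv'_def)
          qed
        qed (simp add: com_defs)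
      qed (use that in \<open>auto simp: Inv'_def J_nset\<close>)
      then show ?thesis by (rule runs_mono) (use k in auto)
    qed
    from runs_SEQ[OF a b] show ?thesis
      by (rule runs_mono) (auto simp: Inv'_def Inv_def dp_table_def less_Suc_eq)
  qed
  have "runs partition_sizes s (4 + (Suc n - 1 + 1) * (max_cost init_opt + (n + 1) * (max_cost improve_opt + 20) + 20)) (Inv (Suc n))"
    unfolding partition_sizes_def
    by (rule runs_SEQ[OF 1], rule runs_FOR, rule_tac [7] body) (auto simp: Inv_def J_nset cap)
  then show ?thesis by (rule runs_mono) (auto simp: Inv_def J_def partition_time_def)
qed

section \<open>Writing out the layout\<close>

definition placed :: "nat \<Rightarrow> state \<Rightarrow> bool" where
  "placed a s \<longleftrightarrow> (\<forall>x<a. nats s 3 x = 0 \<and>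
     Complex (reals s 5 x) (reals s 6 x) = Complex zx zy +
       hub s (nats s choice (n - start (nats s choice) n x)) * turn \<sigma> n (int (start (nats s choice) n x)))"

text \<open>Source j and position i are linked only by equality of points, since the order in which
  the sources are given is arbitrary.\<close>

definition assigned :: "nat \<Rightarrow> nat \<Rightarrow> state \<Rightarrow> bool" where
  "assigned m a s \<longleftrightarrow> (\<forall>i<m. \<forall>j<n. Z j = pt i \<longrightarrow>
     (\<exists>x<a. nats s 2 j = Suc x \<and> start (nats s choice) n x \<le> i \<and> i < start (nats s choice) n (Suc x)))"

lemma placed_nset [simp]: "e \<notin> {3, choice} \<Longrightarrow> placed a (nset e i x s) = placed a s"
  by (simp add: placed_def)

lemma placed_rset [simp]: "e \<notin> {5, 6, hubX, hubY} \<Longrightarrow> placed a (rset e i x s) = placed a s"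
  by (simp add: placed_def)

lemma assigned_nset [simp]: "e \<notin> {2, choice} \<Longrightarrow> assigned m a (nset e i x s) = assigned m a s"
  by (simp add: assigned_def)

lemma assigned_rset [simp]: "assigned m a (rset e i x s) = assigned m a s"
  by (simp add: assigned_def)

lemma pt_quotient:
  "(Re (pt i) * Re (Z 0) + Im (pt i) * Im (Z 0)) / r\<^sup>2 = Re (turn \<sigma> n (int i))"
  "(Im (pt i) * Re (Z 0) - Re (pt i) * Im (Z 0)) / r\<^sup>2 = Im (turn \<sigma> n (int i))"
proof -
  have "turn \<sigma> n (int i) = pt i / Z 0" using Z0_nonzero by (simp add: pt_def)
  then show "(Re (pt i) * Re (Z 0) + Im (pt i) * Im (Z 0)) / r\<^sup>2 = Re (turn \<sigma> n (int i))"
    "(Im (pt i) * Re (Z 0) - Re (pt i) * Im (Z 0)) / r\<^sup>2 = Im (turn \<sigma> n (int i))"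
    using radius_sq_val by (simp_all add: Re_divide Im_divide power2_eq_square)
qed

definition tables_ok :: "state \<Rightarrow> bool" where
  "tables_ok s \<longleftrightarrow> base_ok s \<and> pts_ok n s \<and> priced (Suc n) s \<and> table_ok (Suc n) s"

lemma tables_ok_nset: "e \<notin> {num, cap, choice} \<Longrightarrow> tables_ok (nset e i x s) = tables_ok s"
  by (simp add: tables_ok_def)


lemma runs_write_output:
  assumes "tables_ok s"
  shows "runs write_output s (output_time n)
    (\<lambda>s. tables_ok s \<and> (\<exists>a. nats s 4 0 = a \<and> placed a s \<and> assigned n a s \<and>
       n \<le> start (nats s choice) n a \<and> (\<forall>x<a. start (nats s choice) n x < n)))"
proof -
  \<comment> \<open>\<open>Inv m\<close> holds between iterations: the positions below m are served
    by the groups opened so far. \<open>Mid m\<close> holds within iteration m, once the group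
    containing position m is open and is the latest one.\<close>
  define Inv where "Inv m s \<longleftrightarrow> tables_ok s \<and> (\<exists>a. nats s group_count 0 = a \<and> nats s next_start 0 = start (nats s choice) n a \<and>
      placed a s \<and> assigned m a s \<and> m \<le> start (nats s choice) n a \<and> (\<forall>x<a. start (nats s choice) n x < m))" for m s
  define Mid where "Mid m s \<longleftrightarrow> tables_ok s \<and> nats s iv 0 = m \<and>
      (\<exists>a. nats s group_count 0 = Suc a \<and> nats s next_start 0 = start (nats s choice) n (Suc a) \<and>
      placed (Suc a) s \<and> assigned m (Suc a) s \<and> m < start (nats s choice) n (Suc a) \<and> start (nats s choice) n a \<le> m)" for m s
  have 1: "runs init_output s (max_cost init_output) (Inv 0)"
    by (rule runs_loop_free) (use assms in \<open>auto simp: com_defs Inv_def tables_ok_nset placed_def assigned_def\<close>)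
  have open_group: "runs open_group s (max_cost open_group) (Mid m)"
    if m: "m < n" "Inv m s" "nats s iv 0 = m" "\<not> m < nats s next_start 0" for m s
  proof (rule runs_loop_free)
    let ?C = "nats s choice"
    let ?S = "start ?C n"
    obtain a where a: "tables_ok s" "nats s group_count 0 = a" "nats s next_start 0 = ?S a" "placed a s"
      "assigned m a s" "m \<le> ?S a" "\<forall>x<a. ?S x < m" using m by (auto simp: Inv_def)
    \<comment> \<open>The failed test bounds the next start from above and the invariant bounds it
      from below, so the new group starts exactly at m.\<close>
    have Sa: "?S a = m" using a m by simp
    let ?k = "?C (n - m)"
    let ?w = "hub s ?k * turn \<sigma> n (int m)"
    have ok: "base_ok s" "pts_ok n s" using a by (auto simp: tables_ok_def)
    let ?s = "nset group_count 0 (Suc a) (nset 3 a 0 (rset 6 a (zy + Im ?w) (rset 5 a (zx + Re ?w)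
        (rset rotY 0 (Im (turn \<sigma> n (int m))) (rset rotX 0 (Re (turn \<sigma> n (int m)))
        (nset next_start 0 (m + ?k) (nset kv 0 ?k s)))))))"
    have res: "result open_group s = ?s"
      unfolding open_group_def using m(1,3) a(2) ok
      by (simp add: base_okD pts_okD radius_sq_val pt_quotient hub_def)
    have "dp_entry c (reals s group_cost) (reals s opt) ?C (n - m) (Suc (n - m))"
      using a(1) m(1) unfolding tables_ok_def by (intro dp_tableD[of _ _ _ _ "Suc n"]) auto
    then have k: "1 \<le> ?k" by (simp add: dp_entry_def)
    have "tables_ok ?s" using a(1) by (simp add: tables_ok_def)
    moreover have "placed (Suc a) ?s"
      using a(4) Sa by (auto simp: placed_def less_Suc_eq hub_def complex_eq_iff)
    moreover have "assigned m (Suc a) ?s"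
      using a(5) by (auto simp: assigned_def intro: less_SucI) (meson less_SucI)
    ultimately show "Mid m (result open_group s)"
      unfolding res Mid_def using k Sa m(3) by simp
  qed (simp add: com_defs)
  have cond: "runs (COND in_group SKIP open_group) s
      (bcost in_group + (max_cost SKIP + max_cost open_group) + 1) (Mid m)"
    if m: "m < n" "Inv m s" "nats s iv 0 = m" for m s
  proof (rule runs_COND)
    assume lt: "bval in_group s"
    obtain a where a: "tables_ok s" "nats s group_count 0 = a" "nats s next_start 0 = start (nats s choice) n a" "placed a s"
      "assigned m a s" "m \<le> start (nats s choice) n a" "\<forall>x<a. start (nats s choice) n x < m" using m by (auto simp: Inv_def)
    have "m < start (nats s choice) n a" using lt m a by simp
    moreover from this obtain a' where "a = Suc a'" by (cases a) auto
    ultimately have "Mid m s" using a m by (auto simp: Mid_def simp del: start.simps)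
    then have "runs SKIP s (max_cost SKIP) (Mid m)" by (intro runs_loop_free) auto
    then show "runs SKIP s (max_cost SKIP + max_cost open_group) (Mid m)" by (rule runs_mono) auto
  next
    assume "\<not> bval in_group s"
    then have "runs open_group s (max_cost open_group) (Mid m)" using m by (intro open_group) auto
    then show "runs open_group s (max_cost SKIP + max_cost open_group) (Mid m)" by (rule runs_mono) auto
  qed
  have scan: "runs (FOR jv (NConst 0) (nvar num) assign_source) s ((n + 1) * (max_cost assign_source + 20))
      (\<lambda>s'. Inv (Suc m) s' \<and> nats s' iv 0 = m)" if m: "m < n" "Mid m s" for m s
  proof -
    define Inv' where "Inv' l s \<longleftrightarrow> Mid m s \<and> (\<forall>j<l. Z j = pt m \<longrightarrow> nats s 2 j = nats s group_count 0)" for l s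
    have "runs (FOR jv (NConst 0) (nvar num) assign_source) s ((n - 0 + 1) * (max_cost assign_source + 20)) (Inv' n)"
    proof (rule runs_FOR)
      fix l s assume l: "l < n" "Inv' l s" "nats s jv 0 = l"
      have ok: "base_ok s" "pts_ok n s" "nats s iv 0 = m" using l by (auto simp: Inv'_def Mid_def tables_ok_def)
      show "runs assign_source s (max_cost assign_source) (\<lambda>s'. Inv' (Suc l) s' \<and> nats s' jv 0 = l)"
      proof (rule runs_loop_free)
        show "Inv' (Suc l) (result assign_source s) \<and> nats (result assign_source s) jv 0 = l"
        proof (cases "Z l = pt m")
          case True
          let ?s = "nset 2 l (nats s group_count 0) s"
          have res: "result assign_source s = ?s"
            unfolding assign_source_def using ok l m True by (simp add: base_okD pts_okD)
          have "assigned m a ?s" if "assigned m a s" for a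
            unfolding assigned_def
          proof (intro allI impI)
            fix i j assume ij: "i < m" "j < n" "Z j = pt i"
            \<comment> \<open>The source being assigned lies at position m, so no source at an
              earlier position is overwritten.\<close>
            then have "j \<noteq> l" using True inj_pt[of i m] m by auto
            with that ij show "\<exists>x<a. nats ?s 2 j = Suc x \<and> start (nats ?s choice) n x \<le> i \<and> i < start (nats ?s choice) n (Suc x)"
              unfolding assigned_def by auto
          qed
          then have "Mid m ?s" using l(2) by (auto simp: Inv'_def Mid_def tables_ok_nset)
          then show ?thesis unfolding res using l by (auto simp: Inv'_def less_Suc_eq)
        next
          case False
          then have "Re (Z l) \<noteq> Re (pt m) \<or> Im (Z l) \<noteq> Im (pt m)" by (simp add: complex_eq_iff)
          then have res: "result assign_source s = s"
            unfolding assign_source_def using ok l m by (auto simp: base_okD pts_okD)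
          show ?thesis unfolding res using l False by (auto simp: Inv'_def less_Suc_eq)
        qed
      qed (simp add: com_defs)
    qed (use m in \<open>auto simp: Inv'_def Mid_def tables_ok_nset tables_ok_def base_okD\<close>)
    then show ?thesis
    proof (rule runs_mono)
      fix s assume I: "Inv' n s"
      let ?S = "start (nats s choice) n"
      obtain a where a: "tables_ok s" "nats s iv 0 = m" "nats s group_count 0 = Suc a" "nats s next_start 0 = ?S (Suc a)"
        "placed (Suc a) s" "assigned m (Suc a) s" "m < ?S (Suc a)" "?S a \<le> m"
        and j: "\<And>j. j < n \<Longrightarrow> Z j = pt m \<Longrightarrow> nats s 2 j = Suc a"
        using I by (auto simp: Inv'_def Mid_def simp del: start.simps)
      have "assigned (Suc m) (Suc a) s"
        unfolding assigned_def
      proof (intro allI impI)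
        fix i j' assume ij: "i < Suc m" "j' < n" "Z j' = pt i"
        show "\<exists>x<Suc a. nats s 2 j' = Suc x \<and> ?S x \<le> i \<and> i < ?S (Suc x)"
        proof (cases "i = m")
          case True
          then show ?thesis using j ij a(7,8) by (intro exI[of _ a]) (auto simp del: start.simps)
        next
          case False
          then show ?thesis using a(6) ij by (auto simp: assigned_def simp del: start.simps)
        qed
      qed
      moreover have "\<forall>x<Suc a. ?S x < Suc m"
      proof (intro allI impI)
        fix x assume "x < Suc a"
        then have "?S x \<le> ?S a" by (intro start_mono) simp
        then show "?S x < Suc m" using a(8) by simp
      qed
      ultimately show "Inv (Suc m) s \<and> nats s iv 0 = m"
        using a by (auto simp: Inv_def simp del: start.simps)
    qed auto
  qed
  have 2: "runs (FOR iv (NConst 0) (nvar num)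
       (COND in_group SKIP open_group ;; FOR jv (NConst 0) (nvar num) assign_source)) s
     ((n + 1) * (bcost in_group +
       (max_cost SKIP + max_cost open_group) + 1 + (n + 1) * (max_cost assign_source + 20) + 20)) (Inv n)"
    if "Inv 0 s" for s
  proof -
    have "runs (FOR iv (NConst 0) (nvar num)
       (COND in_group SKIP open_group ;; FOR jv (NConst 0) (nvar num) assign_source)) s
     ((n - 0 + 1) * (bcost in_group +
       (max_cost SKIP + max_cost open_group) + 1 + (n + 1) * (max_cost assign_source + 20) + 20)) (Inv n)"
    proof (rule runs_FOR)
      fix m s assume m: "m < n" "Inv m s" "nats s iv 0 = m"
      show "runs (COND in_group SKIP open_group ;; FOR jv (NConst 0) (nvar num) assign_source) s
        (bcost in_group +
       (max_cost SKIP + max_cost open_group) + 1 + (n + 1) * (max_cost assign_source + 20)) (\<lambda>s'. Inv (Suc m) s' \<and> nats s' iv 0 = m)"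
        by (rule runs_SEQ[OF cond[OF m] scan[OF m(1)]])
    qed (use that in \<open>auto simp: Inv_def tables_ok_nset tables_ok_def base_okD\<close>)
    then show ?thesis by simp
  qed
  have 3: "runs (NASSIGN 4 (NConst 0) (nvar group_count)) s 4
      (\<lambda>s. tables_ok s \<and> (\<exists>a. nats s 4 0 = a \<and> placed a s \<and> assigned n a s \<and>
       n \<le> start (nats s choice) n a \<and> (\<forall>x<a. start (nats s choice) n x < n)))" if "Inv n s" for s
    unfolding runs_def
    using exec_NASSIGN[of 4 "NConst 0" "nvar group_count" s] that
    by (intro exI conjI) (auto simp: Inv_def tables_ok_nset)
  show ?thesis
    unfolding write_output_def output_time_def by (intro runs_SEQ[OF 1] runs_SEQ[OF 2] 3)
qed

end

section \<open>Correctness and running time\<close>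

context oriented_run
begin

lemma Z_image_eq_pt_image: "Z ` {..<n} = pt ` {..<n}"
proof -
  have "{0..<int n} = int ` {..<n}"
    by (metis atLeast0LessThan image_int_atLeastLessThan of_nat_0)
  then show ?thesis
    using equally_spaced_eq_orbit[OF n_pos \<sigma> Z_circle] by (simp add: pt_def image_image)
qed

lemma inj_on_Z: "inj_on Z {..<n}"
proof -
  have "inj_on pt {..<n}" using inj_pt by (auto simp: inj_on_def)
  then have "card (Z ` {..<n}) = n" unfolding Z_image_eq_pt_image by (simp add: card_image)
  then show ?thesis by (intro eq_card_imp_inj_on) auto
qed

context
  fixes I :: flamecast
  assumes inst: "flamecast_instance I" and one_layer: "num_layers I = 1" and one_sink: "length (sinks I) = 1"
    and len: "length (sources I) = n" and alpha: "alpha I = \<alpha>" and cap: "capacities I ! 1 = c"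
    and sink: "sinks I ! 0 = (zx, zy)"
    and src: "\<And>i. i < n \<Longrightarrow> sources I ! i = (zx + Re (Z i), zy + Im (Z i))"
begin

lemma dist_source: "i < n \<Longrightarrow> dist (sources I ! i) x = cmod (Z i - (Complex (fst x) (snd x) - Complex zx zy))"
  using src by (simp add: dist_eq_cmod) (simp add: cmod_def algebra_simps)

lemma dist_sink: "dist x (sinks I ! 0) = cmod (Complex (fst x) (snd x) - Complex zx zy)"
  by (simp add: sink dist_eq_cmod)

lemma sources_nonempty: "sources I \<noteq> []"
  using len n_pos by auto

lemma length_capacities: "length (capacities I) = 3"
  using inst one_layer by (auto simp: flamecast_instance_def num_layers_def)

text \<open>The hubs of any valid layout yield group sizes of at most c with sum n, so the table is
  bounded by their prices, and each price by 1 + \<epsilon> times the cost of the group via its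
  nearest arc. The load of the sink supplies the second claim, the only information on layer 0
  needed for validity of the output.\<close>

lemma table_le_layout_cost:
  assumes L: "valid_layout I L"
    and s: "priced (Suc n) s" "table_ok (Suc n) s"
  shows "reals s opt n \<le> (1 + \<epsilon>) * layout_cost I L" "n \<le> capacities I ! 0"
proof -
  let ?g = "reals s group_cost"
  have facts: "topology I L" "embedding I L" "num_layers I = 1" "length (sinks I) = 1" "sources I \<noteq> []"
    using L one_layer one_sink sources_nonempty by (auto simp: valid_layout_def)
  have root: "Sink 0 \<in> roots L" by (rule sink_in_roots[OF facts])
  then have "Sink 0 \<in> verts L" by (simp add: roots_def)
  then have "load I L (Sink 0) \<le> capacities I ! layer L (Sink 0)" using L by (auto simp: valid_layout_def)
  then show "n \<le> capacities I ! 0" using load_sink[OF facts] layer_root[OF root] len by simp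
  have load: "1 \<le> load I L v \<and> load I L v \<le> c" if v: "v \<in> hubs L" for v
  proof
    have "finite (subtree_sources I L v)" by (simp add: subtree_sources_def)
    then show "1 \<le> load I L v"
      using subtree_sources_nonempty[OF facts v] by (simp add: load_eq_card_subtree_sources Suc_le_eq card_gt_0_iff)
    have e: "(v, Sink 0) \<in> edges L" using v by (simp add: hubs_def)
    have "v \<in> verts L" using edges_in_verts[OF facts e] by simp
    then show "load I L v \<le> c" using L layer_child_of_root[OF e root] cap by (auto simp: valid_layout_def)
  qed
  have sum: "(\<Sum>v\<in>hubs L. load I L v) = n" using sum_load_hubs[OF facts] len by simp
  have fin: "finite (hubs L)" by (rule finite_hubs[OF facts])
  have group: "?g (load I L v) \<le> (1 + \<epsilon>) * ((\<Sum>i\<in>subtree_sources I L v. dist (sources I ! i) (pos L v)) +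
      real (load I L v) powr alpha I * dist (pos L v) (sinks I ! 0))" if v: "v \<in> hubs L" for v
  proof -
    let ?k = "load I L v"
    let ?A = "subtree_sources I L v"
    let ?y = "Complex (fst (pos L v)) (snd (pos L v)) - Complex zx zy"
    have A: "?A \<subseteq> {..<n}" by (auto simp: subtree_sources_def len)
    have injA: "inj_on Z ?A" using inj_on_Z A by (rule inj_on_subset)
    have "Z ` ?A \<subseteq> (\<lambda>i. Z 0 * turn \<sigma> n i) ` {0..<int n}"
      unfolding equally_spaced_eq_orbit[OF n_pos \<sigma> Z_circle, symmetric] using A by auto
    moreover have "card (Z ` ?A) = ?k" using injA by (simp add: card_image load_eq_card_subtree_sources)
    ultimately obtain y' where y': "arc ?k y' \<le> (\<Sum>p\<in>Z ` ?A. cmod (p - ?y)) + real ?k powr \<alpha> * cmod ?y"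
      using arc_cost_le_group_cost[OF n_pos \<sigma> Z0_nonzero] by metis
    have kn: "1 \<le> ?k" "?k < Suc n"
      using load[OF v] member_le_sum[OF v, of "load I L"] fin sum by auto
    then have "?g ?k \<le> (1 + \<epsilon>) * arc ?k y'"
      using s(1) by (auto simp: priced_def near_opt_def)
    also have "(1 + \<epsilon>) * arc ?k y' \<le> (1 + \<epsilon>) * ((\<Sum>p\<in>Z ` ?A. cmod (p - ?y)) + real ?k powr \<alpha> * cmod ?y)"
      using y' eps_pos by (intro mult_left_mono) auto
    also have "(\<Sum>p\<in>Z ` ?A. cmod (p - ?y)) = (\<Sum>i\<in>?A. dist (sources I ! i) (pos L v))"
      using A by (simp add: sum.reindex[OF injA] dist_source subset_iff)
    finally show ?thesis by (simp add: alpha dist_sink)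
  qed
  have "reals s opt n \<le> (\<Sum>v\<in>hubs L. ?g (load I L v))"
    using dp_table_lower_bound[OF s(2) fin, of "load I L"] load sum by simp
  also have "\<dots> \<le> (\<Sum>v\<in>hubs L. (1 + \<epsilon>) * ((\<Sum>i\<in>subtree_sources I L v. dist (sources I ! i) (pos L v)) +
      real (load I L v) powr alpha I * dist (pos L v) (sinks I ! 0)))"
    by (intro sum_mono group)
  also have "\<dots> = (1 + \<epsilon>) * layout_cost I L"
    by (simp add: layout_cost_eq_sum_hubs[OF facts] sum_distrib_left)
  finally show "reals s opt n \<le> (1 + \<epsilon>) * layout_cost I L" .
qed

text \<open>Nothing is lost here: each group is a rotated copy of the arc that was priced, with the
  Steiner point rotated along, so the cost equals the table value exactly.\<close>

lemma output_valid_and_cost: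
  assumes tab: "tables_ok s" and a: "nats s 4 0 = a" "placed a s" "assigned n a s"
    and last: "n \<le> start (nats s choice) n a" "\<forall>x<a. start (nats s choice) n x < n"
    and n_cap: "n \<le> capacities I ! 0"
  shows "valid_layout I (flamecast_output I s)" "layout_cost I (flamecast_output I s) = reals s opt n"
proof -
  let ?C = "nats s choice"
  let ?S = "start ?C n"
  let ?g = "reals s group_cost"
  let ?L = "flamecast_output I s"
  define par where "par j = nats s 2 j - 1" for j
  have table: "table_ok (Suc n) s" and priced: "priced (Suc n) s" using tab by (auto simp: tables_ok_def)
  \<comment> \<open>A chosen size never exceeds the number of sources left, so the last group cannot
    overshoot n.\<close>
  have Sa: "?S a = n" using dp_table_unroll[OF table last(2)] last(1) by simp
  have opt: "reals s opt n = (\<Sum>x<a. ?g (?C (n - ?S x)))"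
    using dp_table_unroll[OF table last(2)] table by (simp add: Sa dp_table_def)
  have size: "1 \<le> ?C (n - ?S x)" "?C (n - ?S x) \<le> c" "?C (n - ?S x) < Suc n" if "x < a" for x
  proof -
    have "dp_entry c ?g (reals s opt) ?C (n - ?S x) (Suc (n - ?S x))"
      using last(2) that by (intro dp_tableD[OF table]) auto
    then show "1 \<le> ?C (n - ?S x)" "?C (n - ?S x) \<le> c" "?C (n - ?S x) < Suc n" by (auto simp: dp_entry_def)
  qed
  have par: "\<exists>i<n. Z j = pt i \<and> par j < a \<and> nats s 2 j = Suc (par j) \<and> ?S (par j) \<le> i \<and> i < ?S (Suc (par j))"
    if j: "j < n" for j
  proof -
    have "Z j \<in> pt ` {..<n}" unfolding Z_image_eq_pt_image[symmetric] using j by simp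
    then obtain i where "i < n" "Z j = pt i" by auto
    then show ?thesis using a(3) j unfolding assigned_def par_def by (metis diff_Suc_1)
  qed
  have group: "Z ` {j. j < n \<and> par j = x} = pt ` {?S x..<?S (Suc x)}" if x: "x < a" for x
  proof (intro equalityI subsetI)
    fix p assume "p \<in> Z ` {j. j < n \<and> par j = x}"
    then obtain j where j: "j < n" "par j = x" "p = Z j" by auto
    then show "p \<in> pt ` {?S x..<?S (Suc x)}" using par[OF j(1)] by (auto simp del: start.simps)
  next
    fix p assume "p \<in> pt ` {?S x..<?S (Suc x)}"
    then obtain i where i: "p = pt i" "?S x \<le> i" "i < ?S (Suc x)" by (auto simp del: start.simps)
    have "?S (Suc x) \<le> ?S a" using x by (intro start_mono) simp
    then have "i < n" using i Sa by simp
    then have "pt i \<in> Z ` {..<n}" unfolding Z_image_eq_pt_image by simp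
    then obtain j where j: "j < n" "pt i = Z j" by auto
    obtain i' where i': "i' < n" "Z j = pt i'" "?S (par j) \<le> i'" "i' < ?S (Suc (par j))" using par[OF j(1)] by blast
    then have "i' = i" using inj_pt[of i' i] j \<open>i < n\<close> by simp
    \<comment> \<open>Position i lies in the window of group \<open>par j\<close> as well as in that
      of group x, and windows of different groups are disjoint.\<close>
    have "par j = x"
    proof (rule ccontr)
      assume "par j \<noteq> x"
      then consider "Suc (par j) \<le> x" | "Suc x \<le> par j" by linarith
      then show False
      proof cases
        case 1
        then have "?S (Suc (par j)) \<le> ?S x" by (rule start_mono)
        then show False using i i' \<open>i' = i\<close> by simp
      next
        case 2
        then have "?S (Suc x) \<le> ?S (par j)" by (rule start_mono)
        then show False using i i' \<open>i' = i\<close> by simp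
      qed
    qed
    then show "p \<in> Z ` {j. j < n \<and> par j = x}" using j i(1) by auto
  qed
  have injA: "inj_on Z {j. j < n \<and> par j = x}" for x
    using inj_on_Z by (rule inj_on_subset) auto
  have inj_window: "inj_on pt {?S x..<?S (Suc x)}" if x: "x < a" for x
  proof -
    have "?S (Suc x) \<le> ?S a" using x by (intro start_mono) simp
    then show ?thesis using Sa inj_pt by (auto simp: inj_on_def simp del: start.simps)
  qed
  have card: "card {j. j < n \<and> par j = x} = ?C (n - ?S x)" if "x < a" for x
    using card_image[OF injA[of x]] card_image[OF inj_window[OF that]] group[OF that] by simp
  have onto: "par ` {..<n} = {..<a}"
  proof (intro equalityI subsetI)
    fix x assume "x \<in> {..<a}"
    \<comment> \<open>Chosen sizes are at least 1, so no group is empty and no Steiner vertex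
      becomes a leaf.\<close>
    then have "{j. j < n \<and> par j = x} \<noteq> {}" using card[of x] size[of x] by (intro notI) simp
    then show "x \<in> par ` {..<n}" by auto
  qed (use par in auto)
  have edges: "edges ?L = star_edges n a par"
  proof -
    have "(\<lambda>i. (Source i, if nats s 2 i < 1 then Sink (nats s 2 i) else Steiner (nats s 2 i - 1))) ` {..<n} =
        (\<lambda>j. (Source j, Steiner (par j))) ` {..<n}"
      by (rule image_cong) (use par in \<open>fastforce simp: par_def\<close>)+
    moreover have "(\<lambda>j. (Steiner j, if nats s 3 j < 1 then Sink (nats s 3 j) else Steiner (nats s 3 j - 1))) ` {..<a} =
        (\<lambda>a. (Steiner a, Sink 0)) ` {..<a}"
      by (rule image_cong) (use a(2) in \<open>auto simp: placed_def\<close>)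
    ultimately show ?thesis
      unfolding flamecast_output_def star_edges_def Let_def one_sink len a(1) by simp
  qed
  have verts: "verts ?L = Field (star_edges n a par)"
    unfolding edges[symmetric] by (simp only: flamecast_output_def Let_def layout.select_convs)
  have emb: "embedding I ?L" by (simp add: embedding_def flamecast_output_def Let_def)
  have c2: "1 \<le> capacities I ! 2"
    using inst length_capacities by (simp add: flamecast_instance_def)
  have caps: "card {j. j < n \<and> par j = x} \<le> capacities I ! 1" if "x < a" for x
    using card[OF that] size[OF that] cap by simp
  note star = star_layout_valid[OF one_layer one_sink sources_nonempty len[symmetric] onto edges verts emb c2 caps n_cap]
  show "valid_layout I ?L" by (rule star(1))
  have "(\<Sum>j | j < n \<and> par j = x. dist (sources I ! j) (pos ?L (Steiner x))) +
      real (card {j. j < n \<and> par j = x}) powr alpha I * dist (pos ?L (Steiner x)) (sinks I ! 0) = ?g (?C (n - ?S x))"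
    if x: "x < a" for x
  proof -
    let ?k = "?C (n - ?S x)"
    let ?w = "hub s ?k"
    let ?t = "turn \<sigma> n (int (?S x))"
    let ?q = "pos ?L (Steiner x)"
    have q: "Complex (fst ?q) (snd ?q) - Complex zx zy = ?w * ?t"
      using a(2) x by (simp add: flamecast_output_def Let_def placed_def)
    have "(\<Sum>j | j < n \<and> par j = x. dist (sources I ! j) ?q) = (\<Sum>j | j < n \<and> par j = x. cmod (Z j - ?w * ?t))"
      by (rule sum.cong) (auto simp: dist_source q)
    also have "\<dots> = (\<Sum>p\<in>pt ` {?S x..<?S (Suc x)}. cmod (p - ?w * ?t))"
      unfolding group[OF x, symmetric] by (simp add: sum.reindex[OF injA])
    also have "\<dots> = (\<Sum>i\<in>{?S x..<?S x + ?k}. cmod (pt i - ?w * ?t))"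
      by (simp add: sum.reindex[OF inj_window[OF x, unfolded start.simps]])
    also have "\<dots> = (\<Sum>i<?k. cmod (Z 0 * turn \<sigma> n (int (?S x) + int i) - ?w * ?t))"
      by (rule sum.reindex_bij_witness[of _ "\<lambda>i. ?S x + i" "\<lambda>i. i - ?S x"]) (auto simp: pt_def)
    finally have "(\<Sum>j | j < n \<and> par j = x. dist (sources I ! j) ?q) + real ?k powr \<alpha> * cmod ?w = arc ?k ?w"
      by (simp add: arc_cost_rotate)
    moreover have "dist ?q (sinks I ! 0) = cmod ?w" unfolding dist_sink q by (simp add: norm_mult)
    moreover have "?g ?k = arc ?k ?w" using priced size[OF x] by (simp add: priced_def)
    ultimately show ?thesis by (simp add: card[OF x] alpha)
  qed
  then show "layout_cost I ?L = reals s opt n"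
    unfolding opt by (subst star(2)) (auto intro!: sum.cong)
qed

end

end

context equally_spaced_run
begin

lemma runs_solver:
  assumes p: "weber_solver p T" "write_bound p \<le> b"
    and inst: "flamecast_instance I" and one_layer: "num_layers I = 1" and one_sink: "length (sinks I) = 1"
    and len: "length (sources I) = n" and alpha: "alpha I = \<alpha>" and cap: "capacities I ! 1 = c"
    and sink: "sinks I ! 0 = (zx, zy)"
    and src: "\<And>i. i < n \<Longrightarrow> sources I ! i = (zx + Re (Z i), zy + Im (Z i))"
    and input: "flamecast_input \<epsilon> I s"
  shows "runs (solver p) s ((4 * time_const) * (n * nat \<lfloor>T n \<epsilon>\<rfloor> + n\<^sup>2))
    (\<lambda>s. (\<exists>L. valid_layout I L) \<longrightarrow> approx_layout \<epsilon> I (flamecast_output I s))"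
proof -
  let ?tW = "nat \<lfloor>T n \<epsilon>\<rfloor>"
  let ?Q = "\<lambda>s. (\<exists>L. valid_layout I L) \<longrightarrow> approx_layout \<epsilon> I (flamecast_output I s)"
  have "length (capacities I) = 3" using inst one_layer by (auto simp: flamecast_instance_def num_layers_def)
  then have read: "runs read_input s (max_cost read_scalars + (n + 1) * (max_cost read_source + 20)) base_ok"
    using input len alpha cap sink src one_sink
    by (intro runs_read_input) (auto simp: flamecast_input_def)
  have rest: "runs (list_points ;; price_groups p ;; partition_sizes ;; write_output) s
      (max_cost init_point + (n + 1) * (max_cost next_point + 20) +
       ((n + 1) * (price_time n ?tW + 20) + (partition_time n + output_time n))) ?Q"
    if s: "base_ok s \<and> (\<exists>\<sigma>. rot_ok \<sigma> s)" for s
  proof -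
    obtain \<sigma> where rot: "rot_ok \<sigma> s" using s by blast
    \<comment> \<open>The orientation is known only from the state after the search, so it is fixed
      here rather than for the whole run.\<close>
    interpret oriented_run b n c \<epsilon> \<alpha> zx zy r \<theta> Z \<sigma>
      by unfold_locales (use rot in \<open>auto simp: rot_ok_def\<close>)
    note inst_facts = inst one_layer one_sink len alpha cap sink src
    have "?Q s'" if "tables_ok s' \<and> (\<exists>a. nats s' 4 0 = a \<and> placed a s' \<and> assigned n a s' \<and>
       n \<le> start (nats s' choice) n a \<and> (\<forall>x<a. start (nats s' choice) n x < n))" for s'
    proof
      assume "\<exists>L. valid_layout I L"
      then obtain L where L: "valid_layout I L" by blast
      have ok: "priced (Suc n) s'" "table_ok (Suc n) s'" using that by (auto simp: tables_ok_def)
      have "n \<le> capacities I ! 0" by (rule table_le_layout_cost(2)[OF inst_facts L ok])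
      then have "valid_layout I (flamecast_output I s')" "layout_cost I (flamecast_output I s') = reals s' opt n"
        using that output_valid_and_cost[OF inst_facts] by blast+
      then show "approx_layout \<epsilon> I (flamecast_output I s')"
        using table_le_layout_cost(1)[OF inst_facts _ ok] by (simp add: approx_layout_def)
    qed
    note out = runs_mono[OF runs_write_output order_refl this]
    show ?thesis
    proof (rule runs_SEQ[OF runs_list_points])
      show "base_ok s" "rot_ok \<sigma> s" using s rot by auto
      fix s1 assume s1: "base_ok s1 \<and> pts_ok n s1"
      show "runs (price_groups p ;; partition_sizes ;; write_output) s1
          ((n + 1) * (price_time n ?tW + 20) + (partition_time n + output_time n)) ?Q"
      proof (rule runs_SEQ[OF runs_price_groups[OF p]])
        show "base_ok s1" "pts_ok n s1" using s1 by auto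
        fix s2 assume s2: "base_ok s2 \<and> pts_ok n s2 \<and> priced (Suc n) s2"
        show "runs (partition_sizes ;; write_output) s2 (partition_time n + output_time n) ?Q"
          by (rule runs_SEQ[OF runs_partition_sizes out]) (use s2 in \<open>auto simp: tables_ok_def\<close>)
      qed
    qed
  qed
  have "runs (solver p) s (total_time n ?tW) ?Q"
    unfolding solver_def total_time_def by (intro runs_SEQ[OF read] runs_SEQ[OF runs_find_rotation] rest)
  then show ?thesis by (rule runs_mono) (auto intro: total_time_le[OF n_pos])
qed

end

text \<open>A one-point problem exhibits an actual running time below the bound. This is needed
  because rounding a negative bound to a natural number would raise it to 0.\<close>

lemma weber_solver_time_nonneg:
  assumes "weber_solver p T" "\<epsilon> > 0" "n \<ge> 1"
  shows "0 \<le> T n \<epsilon>"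
proof -
  let ?s = "\<lparr>nats = \<lambda>_ _. 1, reals = \<lambda>a _. if a = 0 then \<epsilon> else if a = 3 then 1 else 0\<rparr>"
  let ?P = "[((0, 0), 1)] :: (point \<times> real) list"
  have "weighted_point_set ?P" "weber_input \<epsilon> ?P ?s" "length ?P \<le> n"
    using assms(3) by (auto simp: weighted_point_set_def weber_input_def)
  then obtain t where "real t \<le> T n \<epsilon>" using assms(1,2) unfolding weber_solver_def by blast
  then show ?thesis by linarith
qed

text \<open>The sink is the centre of the circle, so subtracting it turns the sources into complex
  numbers of modulus r.\<close>

lemma circular_instance_coordinates:
  assumes circ: "source_equally_spaced_circular I" and one_sink: "length (sinks I) = 1" and len: "length (sources I) = n"
  obtains r \<theta> Z where "r > 0" "Z ` {..<n} = (\<lambda>i. rcis r (\<theta> + 2 * pi * real i / real n)) ` {..<n}"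
    "\<forall>i<n. sources I ! i = (fst (sinks I ! 0) + Re (Z i), snd (sinks I ! 0) + Im (Z i))"
proof -
  obtain z r \<theta> where z: "circular_about I z r" "set (sources I) =
      (\<lambda>i. z + r *\<^sub>R (cos (\<theta> + 2 * pi * real i / real n), sin (\<theta> + 2 * pi * real i / real n))) ` {..<n}"
    using circ len unfolding source_equally_spaced_circular_def by auto
  have "sinks I ! 0 \<in> set (sinks I)" using one_sink by simp
  then have sink: "sinks I ! 0 = z" using z(1) by (auto simp: circular_about_def)
  define F where "F q = Complex (fst q - fst z) (snd q - snd z)" for q :: point
  define Z where "Z i = F (sources I ! i)" for i
  have "Z ` {..<n} = F ` set (sources I)"
    unfolding Z_def set_conv_nth len by auto
  also have "\<dots> = (\<lambda>i. rcis r (\<theta> + 2 * pi * real i / real n)) ` {..<n}"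
    unfolding z(2) image_image by (rule image_cong) (auto simp: F_def complex_eq_iff)
  finally have Zi: "Z ` {..<n} = (\<lambda>i. rcis r (\<theta> + 2 * pi * real i / real n)) ` {..<n}" .
  have "sources I ! i = (fst (sinks I ! 0) + Re (Z i), snd (sinks I ! 0) + Im (Z i))" for i
    by (simp add: Z_def F_def sink)
  moreover have "r > 0" using z(1) by (simp add: circular_about_def)
  ultimately show ?thesis using that Zi by blast
qed

theorem lemma26:
  fixes T_Weber :: "nat \<Rightarrow> real \<Rightarrow> real"
  assumes "\<exists>p. weber_solver p T_Weber"
  shows "\<exists>q K. \<forall>n\<ge>1. \<forall>\<epsilon>>0. \<forall>I s.
           flamecast_instance I \<and> source_equally_spaced_circular I \<and>
           num_layers I = 1 \<and> length (sinks I) = 1 \<and> length (sources I) = n \<and>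
           flamecast_input \<epsilon> I s \<longrightarrow>
           (\<exists>t s'. exec q s t s' \<and>
              real t \<le> K * (real n * T_Weber n \<epsilon> + (real n)\<^sup>2) \<and>
              ((\<exists>L. valid_layout I L) \<longrightarrow> approx_layout \<epsilon> I (flamecast_output I s')))"
proof -
  obtain p where p: "weber_solver p T_Weber" using assms by blast
  \<comment> \<open>The program and the constant depend on \<open>b\<close>, hence on the Weber
    solver alone, and are fixed before n, \<epsilon> and the instance.\<close>
  define b where "b = write_bound p"
  let ?K = "4 * arrays.time_const b"
  have "\<exists>t s'. exec (arrays.solver b p) s t s' \<and> real t \<le> real ?K * (real n * T_Weber n \<epsilon> + (real n)\<^sup>2) \<and>
      ((\<exists>L. valid_layout I L) \<longrightarrow> approx_layout \<epsilon> I (flamecast_output I s'))"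
    if n: "n \<ge> 1" and \<epsilon>: "\<epsilon> > 0"
      and I: "flamecast_instance I" "source_equally_spaced_circular I" "num_layers I = 1" "length (sinks I) = 1"
        "length (sources I) = n" "flamecast_input \<epsilon> I s" for n \<epsilon> I s
  proof -
    obtain r \<theta> Z where Z: "r > 0" "Z ` {..<n} = (\<lambda>i. rcis r (\<theta> + 2 * pi * real i / real n)) ` {..<n}"
      "\<And>i. i < n \<Longrightarrow> sources I ! i = (fst (sinks I ! 0) + Re (Z i), snd (sinks I ! 0) + Im (Z i))"
      by (rule circular_instance_coordinates[OF I(2,4,5)]) (rule that, auto)
    have "1 < length (capacities I)" using I(1) by (auto simp: flamecast_instance_def)
    then have c: "1 \<le> capacities I ! 1" using I(1) by (auto simp: flamecast_instance_def)
    interpret equally_spaced_run b n "capacities I ! 1" \<epsilon> "alpha I" "fst (sinks I ! 0)" "snd (sinks I ! 0)" r \<theta> Z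
      by unfold_locales (use n \<epsilon> c Z in auto)
    let ?tW = "nat \<lfloor>T_Weber n \<epsilon>\<rfloor>"
    have "runs (solver p) s (?K * (n * ?tW + n\<^sup>2))
        (\<lambda>s. (\<exists>L. valid_layout I L) \<longrightarrow> approx_layout \<epsilon> I (flamecast_output I s))"
      by (rule runs_solver[OF p _ I(1,3,4,5) refl refl _ Z(3) I(6)]) (simp_all add: b_def)
    then obtain t s' where t: "exec (solver p) s t s'" "t \<le> ?K * (n * ?tW + n\<^sup>2)"
      "(\<exists>L. valid_layout I L) \<longrightarrow> approx_layout \<epsilon> I (flamecast_output I s')"
      unfolding runs_def by blast
    have "real t \<le> real (?K * (n * ?tW + n\<^sup>2))" using t(2) by (simp only: of_nat_le_iff)
    also have "\<dots> = real ?K * (real n * real ?tW + (real n)\<^sup>2)" by simp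
    also have "\<dots> \<le> real ?K * (real n * T_Weber n \<epsilon> + (real n)\<^sup>2)"
      using weber_solver_time_nonneg[OF p \<epsilon> n] by (intro mult_left_mono add_mono) auto
    finally show ?thesis using t(1,3) by (intro exI conjI)
  qed
  then show ?thesis by (intro exI[of _ "arrays.solver b p"] exI[of _ "real ?K"] allI impI) (elim conjE)
qed

end
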